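(* Let $G$ be a countable group with a generating probability measure $\mu$, and suppose $G$ has only countably many amenable subgroups. Then there exists a normal amenable subgroup $N\trianglelefteq G$ such that the stabilizer $\{g\in G: gx=x\}$ of almost every point $x$ of the Poisson boundary $\Pi(G,\mu)$ equals $N$.
   Context: $\mu$ is generating if its support generates $G$ as a semigroup. The Poisson boundary $\Pi(G,\mu)$ is the Mackey point realization of the shift-invariant $\sigma$-algebra of $(G^{\mathbb N},\mathbb P_\mu)$, where $\mathbb P_\mu$ is the law of $(g_1,g_1g_2,g_1g_2g_3,\dots)$ with $g_i$ i.i.d. of law $\mu$, equipped with the induced $G$-action and measure; "almost every" refers to that measure. *)

theory Defs
  imports "HOL-Probability.Probability" "HOL-Algebra.Coset"
begin

inductive_set gen_semigroup :: "('a, 'b) monoid_scheme \<Rightarrow> 'a set \<Rightarrow> 'a set"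
  for G S where
  gen_base: "s \<in> S \<Longrightarrow> s \<in> gen_semigroup G S"
| gen_mult: "a \<in> gen_semigroup G S \<Longrightarrow> b \<in> gen_semigroup G S
      \<Longrightarrow> a \<otimes>\<^bsub>G\<^esub> b \<in> gen_semigroup G S"

definition generating :: "('a, 'b) monoid_scheme \<Rightarrow> 'a pmf \<Rightarrow> bool" where
  "generating G \<mu> \<longleftrightarrow> set_pmf \<mu> \<subseteq> carrier G \<and> gen_semigroup G (set_pmf \<mu>) = carrier G"

definition amenable_subgroup :: "('a, 'b) monoid_scheme \<Rightarrow> 'a set \<Rightarrow> bool" where
  "amenable_subgroup G H \<longleftrightarrow> subgroup H G \<and>
    (\<exists>m :: ('a \<Rightarrow> real) \<Rightarrow> real.
       (\<forall>f g. (\<forall>x\<in>H. f x = g x) \<longrightarrow> m f = m g) \<and>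
       (\<forall>f g a b. bounded (f ` H) \<longrightarrow> bounded (g ` H) \<longrightarrow>
           m (\<lambda>x. a * f x + b * g x) = a * m f + b * m g) \<and>
       (\<forall>f. bounded (f ` H) \<longrightarrow> (\<forall>x\<in>H. 0 \<le> f x) \<longrightarrow> 0 \<le> m f) \<and>
       m (\<lambda>_. 1) = 1 \<and>
       (\<forall>f h. bounded (f ` H) \<longrightarrow> h \<in> H \<longrightarrow> m (\<lambda>x. f (h \<otimes>\<^bsub>G\<^esub> x)) = m f))"

definition path_space :: "(nat \<Rightarrow> 'a) measure" where
  "path_space = PiM UNIV (\<lambda>_. count_space UNIV)"

primrec walk :: "('a, 'b) monoid_scheme \<Rightarrow> (nat \<Rightarrow> 'a) \<Rightarrow> nat \<Rightarrow> 'a" where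
  "walk G w 0 = w 0"
| "walk G w (Suc n) = walk G w n \<otimes>\<^bsub>G\<^esub> w (Suc n)"

definition path_measure :: "('a, 'b) monoid_scheme \<Rightarrow> 'a pmf \<Rightarrow> (nat \<Rightarrow> 'a) measure" where
  "path_measure G \<mu> = distr (PiM UNIV (\<lambda>_. measure_pmf \<mu>)) path_space (walk G)"

definition shift :: "(nat \<Rightarrow> 'a) \<Rightarrow> nat \<Rightarrow> 'a" where
  "shift x = (\<lambda>n. x (Suc n))"

definition shift_invariant_sets :: "(nat \<Rightarrow> 'a) set set" where
  "shift_invariant_sets = {A \<in> sets path_space. shift -` A \<inter> space path_space = A}"

definition path_act :: "('a, 'b) monoid_scheme \<Rightarrow> 'a \<Rightarrow> (nat \<Rightarrow> 'a) \<Rightarrow> nat \<Rightarrow> 'a" where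
  "path_act G g x = (\<lambda>n. g \<otimes>\<^bsub>G\<^esub> x n)"

(* (B, act) is a Mackey point realization of the Poisson boundary Pi(G,mu), via the
   factor map pi : path space -> B:  B is a standard Borel space (a Borel subset of
   a Polish space with the induced Borel structure), G acts on it by Borel maps,
   pi is measurable w.r.t. the shift-invariant sigma-algebra, pi^{-1}(sets B) equals
   the shift-invariant sigma-algebra modulo P_mu-null sets, pi is G-equivariant
   (P_mu-a.e.), and the measure of B is the push-forward of P_mu. *)
definition poisson_boundary ::
  "('a, 'b) monoid_scheme \<Rightarrow> 'a pmf \<Rightarrow> ('c::polish_space) measure \<Rightarrow>
   ('a \<Rightarrow> 'c \<Rightarrow> 'c) \<Rightarrow> ((nat \<Rightarrow> 'a) \<Rightarrow> 'c) \<Rightarrow> bool" where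
  "poisson_boundary G \<mu> B act \<pi> \<longleftrightarrow>
     space B \<in> sets borel \<and> sets B = sets (restrict_space borel (space B)) \<and>
     (\<forall>g\<in>carrier G. act g \<in> measurable B B) \<and>
     (\<forall>x\<in>space B. act \<one>\<^bsub>G\<^esub> x = x) \<and>
     (\<forall>g\<in>carrier G. \<forall>h\<in>carrier G. \<forall>x\<in>space B.
        act (g \<otimes>\<^bsub>G\<^esub> h) x = act g (act h x)) \<and>
     \<pi> \<in> measurable path_space B \<and>
     (\<forall>E\<in>sets B. \<pi> -` E \<inter> space path_space \<in> shift_invariant_sets) \<and>
     (\<forall>A\<in>shift_invariant_sets. \<exists>E\<in>sets B.
        emeasure (path_measure G \<mu>)
          ((A - \<pi> -` E) \<union> ((\<pi> -` E \<inter> space path_space) - A)) = 0) \<and>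
     (\<forall>g\<in>carrier G. AE x in path_measure G \<mu>. \<pi> (path_act G g x) = act g (\<pi> x)) \<and>
     distr (path_measure G \<mu>) B \<pi> = B"

definition stabilizer :: "('a, 'b) monoid_scheme \<Rightarrow> ('a \<Rightarrow> 'c \<Rightarrow> 'c) \<Rightarrow> 'c \<Rightarrow> 'a set" where
  "stabilizer G act x = {g \<in> carrier G. act g x = x}"

end

theory Submission
  imports Defs
begin

text \<open>
  Almost every stabilizer is amenable. Fix a Banach limit. For a bounded function \<open>F\<close> on the
  group, the Banach limit of the expectations of \<open>F (g X\<^sub>n)\<close> is a bounded harmonic function
  of \<open>g\<close>; along the walk it converges almost surely, and its limit is a shift-invariant function
  \<open>\<Phi>\<^sub>F\<close>, hence a function on the boundary. If \<open>S\<close> fixes a set of boundary points of positive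
  measure, averaging \<open>\<Phi>\<^sub>F\<close> over that set is an \<open>S\<close>-invariant mean on the group. There are
  only countably many finite \<open>S\<close>, so for almost every point each finite subset of its stabilizer
  admits such a mean; a limit along an ultrafilter of finite subsets gives a mean invariant under the
  whole stabilizer.

  Consequently the stabilizer takes countably many values almost surely. Let \<open>N\<close> be a value of
  maximal probability. The probability that the boundary point of the walk started at \<open>g\<close> has
  stabilizer \<open>N\<close> is harmonic in \<open>g\<close> and equals the probability of the conjugate
  \<open>g\<^sup>-\<^sup>1 N g\<close>, so it is maximal at the identity and therefore constant. A shift-invariant event
  whose probability does not depend on the starting point is independent of every cylinder, so of
  itself. Hence \<open>N\<close> and all of its conjugates have probability one, and \<open>N\<close> is normal.
\<close>

section \<open>Ultrafilter limits\<close>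

text \<open>Zorn's lemma for proper filters finer than \<open>F\<close>, in the reversed order. A
  minimal one is an ultrafilter.\<close>

lemma exists_minimal_filter:
  fixes F :: "'i filter"
  assumes "F \<noteq> bot"
  obtains U where "U \<noteq> bot" "U \<le> F" "\<And>V. V \<noteq> bot \<Longrightarrow> V \<le> U \<Longrightarrow> V = U"
proof -
  let ?A = "{V. V \<noteq> bot \<and> V \<le> F}"
  have "\<exists>m\<in>?A. \<forall>a\<in>?A. a \<le> m \<longrightarrow> a = m"
  proof (rule predicate_Zorn[where P = "\<lambda>x y. y \<le> x"])
    show "partial_order_on ?A (relation_of (\<lambda>x y. y \<le> x) ?A)"
      by (rule partial_order_on_relation_ofI) auto
  next
    fix C assume C: "C \<in> Chains (relation_of (\<lambda>x y. y \<le> x) ?A)"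
    then have CA: "C \<subseteq> ?A" and tot: "\<And>x y. x \<in> C \<Longrightarrow> y \<in> C \<Longrightarrow> x \<le> y \<or> y \<le> x"
      by (auto simp: Chains_def relation_of_def)
    show "\<exists>u\<in>?A. \<forall>a\<in>C. u \<le> a"
    proof (cases "C = {}")
      case True
      then show ?thesis using assms by auto
    next
      case False
      \<comment> \<open>Over a chain the predicates of the infimum are just those of its members, so
        the infimum is improper only if some member is.\<close>
      have "eventually (\<lambda>_. False) (Inf C) \<longleftrightarrow> (\<exists>b\<in>C. eventually (\<lambda>_. False) b)"
        using False tot by (intro eventually_Inf_base) (auto simp: le_inf_iff)
      then have "Inf C \<noteq> bot"
        using CA by (auto simp: trivial_limit_def)
      moreover have "Inf C \<le> F"
      proof -
        obtain x where "x \<in> C" using False by blast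
        then show ?thesis using CA by (intro Inf_lower2[of x]) auto
      qed
      ultimately show ?thesis by (intro bexI[of _ "Inf C"]) (auto intro: Inf_lower)
    qed
  qed
  then show ?thesis using that by (auto intro: order_trans)
qed

text \<open>Compactness gives a bounded function a cluster point along the filter, and minimality of
  the filter turns it into a limit. A single filter serves all bounded functions at once.\<close>

lemma exists_bounded_convergence_filter:
  fixes F :: "'i filter"
  assumes "F \<noteq> bot"
  obtains U where "U \<noteq> bot" "U \<le> F"
    "\<And>f :: 'i \<Rightarrow> real. bounded (range f) \<Longrightarrow> (f \<longlongrightarrow> Lim U f) U"
proof -
  obtain U where U: "U \<noteq> bot" "U \<le> F" "\<And>V. V \<noteq> bot \<Longrightarrow> V \<le> U \<Longrightarrow> V = U"
    using exists_minimal_filter[OF assms] by blast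
  have "(f \<longlongrightarrow> Lim U f) U" if f: "bounded (range f)" for f :: "'i \<Rightarrow> real"
  proof -
    obtain C where C: "\<And>i. \<bar>f i\<bar> \<le> C" using f by (auto simp: bounded_iff)
    have "compact {-C..C}" by simp
    moreover have "filtermap f U \<noteq> bot" using U(1) by (simp add: filtermap_bot_iff)
    moreover have "eventually (\<lambda>x. x \<in> {-C..C}) (filtermap f U)"
      using C by (auto simp: eventually_filtermap abs_le_iff minus_le_iff)
    ultimately obtain x where x: "inf (nhds x) (filtermap f U) \<noteq> bot"
      unfolding compact_filter by blast
    \<comment> \<open>Pulling the neighbourhoods of the cluster point back along \<open>f\<close>
      refines \<open>U\<close> to a filter that is still proper. By minimality the refinement is
      \<open>U\<close> itself, which is convergence to \<open>x\<close>.\<close>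
    have "inf (filtercomap f (nhds x)) U \<noteq> bot"
    proof
      assume "inf (filtercomap f (nhds x)) U = bot"
      then obtain P Q where P: "eventually P (filtercomap f (nhds x))" and Q: "eventually Q U"
        and PQ: "\<And>i. P i \<Longrightarrow> Q i \<Longrightarrow> False"
        by (auto simp: trivial_limit_def eventually_inf)
      obtain R where R: "eventually R (nhds x)" and RP: "\<And>i. R (f i) \<Longrightarrow> P i"
        using P by (auto simp: eventually_filtercomap)
      have "eventually (\<lambda>y. \<not> R y) (filtermap f U)"
        using Q by (auto simp: eventually_filtermap elim!: eventually_mono dest: RP PQ)
      with R have "inf (nhds x) (filtermap f U) = bot"
        unfolding trivial_limit_def eventually_inf by blast
      with x show False by simp
    qed
    then have "inf (filtercomap f (nhds x)) U = U" by (intro U(3)) auto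
    then have "U \<le> filtercomap f (nhds x)" by (metis inf_le1)
    then have "(f \<longlongrightarrow> x) U" by (simp add: filterlim_iff_le_filtercomap)
    then show ?thesis using tendsto_Lim[OF U(1)] by blast
  qed
  with U that show ?thesis by blast
qed

section \<open>Means\<close>

text \<open>The clauses of \<open>amenable_subgroup\<close> without invariance, so that one notion
  covers averages over time, over the group and over a subgroup. Arguments are total functions; the
  first clause restricts attention to their values on \<open>A\<close>.\<close>

definition mean_on :: "'i set \<Rightarrow> (('i \<Rightarrow> real) \<Rightarrow> real) \<Rightarrow> bool" where
  "mean_on A m \<longleftrightarrow>
     (\<forall>f g. (\<forall>x\<in>A. f x = g x) \<longrightarrow> m f = m g) \<and>
     (\<forall>f g a b. bounded (f ` A) \<longrightarrow> bounded (g ` A) \<longrightarrow>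
        m (\<lambda>x. a * f x + b * g x) = a * m f + b * m g) \<and>
     (\<forall>f. bounded (f ` A) \<longrightarrow> (\<forall>x\<in>A. 0 \<le> f x) \<longrightarrow> 0 \<le> m f) \<and>
     m (\<lambda>_. 1) = 1"

lemma mean_onI:
  assumes "\<And>f g. (\<And>x. x \<in> A \<Longrightarrow> f x = g x) \<Longrightarrow> m f = m g"
    and "\<And>f g a b. bounded (f ` A) \<Longrightarrow> bounded (g ` A) \<Longrightarrow>
        m (\<lambda>x. a * f x + b * g x) = a * m f + b * m g"
    and "\<And>f. bounded (f ` A) \<Longrightarrow> (\<And>x. x \<in> A \<Longrightarrow> 0 \<le> f x) \<Longrightarrow> 0 \<le> m f"
    and "m (\<lambda>_. 1) = 1"
  shows "mean_on A m"
  unfolding mean_on_def by (intro conjI allI impI) (use assms in blast)+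

lemma
  assumes "mean_on A m"
  shows mean_on_cong: "(\<And>x. x \<in> A \<Longrightarrow> f x = g x) \<Longrightarrow> m f = m g"
    and mean_on_linear: "bounded (f ` A) \<Longrightarrow> bounded (g ` A) \<Longrightarrow>
        m (\<lambda>x. a * f x + b * g x) = a * m f + b * m g"
    and mean_on_nonneg: "bounded (f ` A) \<Longrightarrow> (\<And>x. x \<in> A \<Longrightarrow> 0 \<le> f x) \<Longrightarrow> 0 \<le> m f"
    and mean_on_one: "m (\<lambda>_. 1) = 1"
proof -
  show "(\<And>x. x \<in> A \<Longrightarrow> f x = g x) \<Longrightarrow> m f = m g"
    using assms unfolding mean_on_def by presburger
  show "bounded (f ` A) \<Longrightarrow> bounded (g ` A) \<Longrightarrow>
        m (\<lambda>x. a * f x + b * g x) = a * m f + b * m g"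
    using assms unfolding mean_on_def by presburger
  show "bounded (f ` A) \<Longrightarrow> (\<And>x. x \<in> A \<Longrightarrow> 0 \<le> f x) \<Longrightarrow> 0 \<le> m f"
    using assms unfolding mean_on_def by presburger
  show "m (\<lambda>_. 1) = 1" using assms unfolding mean_on_def by presburger
qed

lemma bounded_const_image: "bounded ((\<lambda>_. c) ` A)"
  by (rule bounded_subset[of "{c}"]) auto

lemma mean_on_const: "mean_on A m \<Longrightarrow> m (\<lambda>_. c) = c"
  using mean_on_linear[of A m "\<lambda>_. 1" "\<lambda>_. 1" c 0] mean_on_one[of A m]
  by (simp add: bounded_const_image)

lemma mean_on_diff:
  "mean_on A m \<Longrightarrow> bounded (f ` A) \<Longrightarrow> bounded (g ` A) \<Longrightarrow> m (\<lambda>x. f x - g x) = m f - m g"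
  using mean_on_linear[of A m f g 1 "-1"] by simp

lemma mean_on_sum:
  assumes m: "mean_on A m" and T: "finite T" and f: "\<And>s. s \<in> T \<Longrightarrow> bounded (f s ` A)"
  shows "m (\<lambda>x. \<Sum>s\<in>T. c s * f s x) = (\<Sum>s\<in>T. c s * m (f s))"
proof -
  \<comment> \<open>Boundedness of the partial sums is carried through the induction because
    linearity of \<open>m\<close> requires it.\<close>
  have "bounded ((\<lambda>x. \<Sum>s\<in>T. c s * f s x) ` A) \<and>
      m (\<lambda>x. \<Sum>s\<in>T. c s * f s x) = (\<Sum>s\<in>T. c s * m (f s))"
    using T f
  proof (induction T rule: finite_induct)
    case empty
    then show ?case using mean_on_const[OF m, of 0] by (simp add: bounded_const_image)
  next
    case (insert t T)
    let ?g = "\<lambda>x. \<Sum>s\<in>T. c s * f s x"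
    have ft: "bounded (f t ` A)" and g: "bounded (?g ` A)"
      and mg: "m ?g = (\<Sum>s\<in>T. c s * m (f s))" using insert by auto
    obtain C D where "\<And>x. x \<in> A \<Longrightarrow> \<bar>f t x\<bar> \<le> C" "\<And>x. x \<in> A \<Longrightarrow> \<bar>?g x\<bar> \<le> D"
      using ft g by (auto simp: bounded_iff)
    then have "\<And>x. x \<in> A \<Longrightarrow> \<bar>c t * f t x + ?g x\<bar> \<le> \<bar>c t\<bar> * C + D"
      by (intro order_trans[OF abs_triangle_ineq] add_mono) (auto simp: abs_mult mult_left_mono)
    then have "bounded ((\<lambda>x. c t * f t x + ?g x) ` A)" unfolding bounded_iff by auto
    then show ?case
      using insert(1,2) mean_on_linear[OF m ft g, of "c t" 1] mg by simp
  qed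
  then show ?thesis ..
qed

lemma mean_on_abs_le:
  assumes m: "mean_on A m" and C: "\<And>x. x \<in> A \<Longrightarrow> \<bar>f x\<bar> \<le> C"
  shows "\<bar>m f\<bar> \<le> C"
proof -
  have b: "bounded (f ` A)" "bounded ((\<lambda>_. C) ` A)" using C by (auto simp: bounded_iff)
  \<comment> \<open>Positivity is applied to C - f and C + f; the coefficients 1 are written out to
    match \<open>mean_on_linear\<close>.\<close>
  have "0 \<le> m (\<lambda>x. C - f x)" "0 \<le> m (\<lambda>x. 1 * C + 1 * f x)"
    using C by (intro mean_on_nonneg[OF m]; force simp: bounded_iff abs_le_iff
        intro!: exI[of _ "2 * C"])+
  then show ?thesis
    unfolding mean_on_diff[OF m b(2) b(1)] mean_on_linear[OF m b(2) b(1)]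
    by (simp add: mean_on_const[OF m] abs_le_iff)
qed

text \<open>By \<open>mean_on_abs_le\<close> the values of all \<open>m i\<close> at one bounded
  function lie in a common interval, so the limits along \<open>U\<close> exist; the properties of a
  mean pass to pointwise limits.\<close>

lemma mean_on_Lim:
  assumes U: "U \<noteq> bot" "\<And>f :: 'i \<Rightarrow> real. bounded (range f) \<Longrightarrow> (f \<longlongrightarrow> Lim U f) U"
    and m: "\<And>i. mean_on A (m i)"
  shows "mean_on A (\<lambda>f. Lim U (\<lambda>i. m i f))"
    and "\<And>f. bounded (f ` A) \<Longrightarrow> ((\<lambda>i. m i f) \<longlongrightarrow> Lim U (\<lambda>i. m i f)) U"
proof -
  show lim: "((\<lambda>i. m i f) \<longlongrightarrow> Lim U (\<lambda>i. m i f)) U" if f: "bounded (f ` A)" for f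
  proof -
    obtain C where "\<And>x. x \<in> A \<Longrightarrow> \<bar>f x\<bar> \<le> C" using f by (auto simp: bounded_iff)
    then have "\<And>i. \<bar>m i f\<bar> \<le> C" using mean_on_abs_le[OF m] by blast
    then have "bounded (range (\<lambda>i. m i f))" by (auto simp: bounded_iff)
    then show ?thesis by (rule U(2))
  qed
  show "mean_on A (\<lambda>f. Lim U (\<lambda>i. m i f))"
  proof (rule mean_onI)
    fix f g :: "'a \<Rightarrow> real" assume "\<And>x. x \<in> A \<Longrightarrow> f x = g x"
    then show "Lim U (\<lambda>i. m i f) = Lim U (\<lambda>i. m i g)"
      by (intro arg_cong[where f = "Lim U"] ext mean_on_cong[OF m])
  next
    fix f g :: "'a \<Rightarrow> real" and a b :: real
    assume f: "bounded (f ` A)" and g: "bounded (g ` A)"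
    have "((\<lambda>i. a * m i f + b * m i g) \<longlongrightarrow> a * Lim U (\<lambda>i. m i f) + b * Lim U (\<lambda>i. m i g)) U"
      by (intro tendsto_intros lim f g)
    then show "Lim U (\<lambda>i. m i (\<lambda>x. a * f x + b * g x)) =
        a * Lim U (\<lambda>i. m i f) + b * Lim U (\<lambda>i. m i g)"
      unfolding mean_on_linear[OF m f g] by (rule tendsto_Lim[OF U(1)])
  next
    fix f :: "'a \<Rightarrow> real" assume f: "bounded (f ` A)" and nn: "\<And>x. x \<in> A \<Longrightarrow> 0 \<le> f x"
    show "0 \<le> Lim U (\<lambda>i. m i f)"
      using mean_on_nonneg[OF m f nn]
      by (intro tendsto_lowerbound[OF lim[OF f]] U(1)) auto
  next
    show "Lim U (\<lambda>i. m i (\<lambda>_. 1)) = 1"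
      using mean_on_one[OF m] by (intro tendsto_Lim[OF U(1)]) simp
  qed
qed

text \<open>Cesaro averages followed by a limit along a filter finer than
  \<open>sequentially\<close>. A shift changes an average only by a telescoped boundary term of
  order 1/N.\<close>

lemma banach_limit_exists:
  obtains L :: "(nat \<Rightarrow> real) \<Rightarrow> real"
  where "mean_on UNIV L" "\<And>f. bounded (range f) \<Longrightarrow> L (\<lambda>n. f (Suc n)) = L f"
proof -
  obtain U :: "nat filter" where U: "U \<noteq> bot" "U \<le> sequentially"
    "\<And>f :: nat \<Rightarrow> real. bounded (range f) \<Longrightarrow> (f \<longlongrightarrow> Lim U f) U"
    using exists_bounded_convergence_filter[OF sequentially_bot] by blast
  \<comment> \<open>Averaging \<open>Suc N\<close> terms avoids an empty average.\<close>
  define c where "c N f = (\<Sum>n<Suc N. f n) / real (Suc N)" for N and f :: "nat \<Rightarrow> real"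
  have c: "mean_on UNIV (c N)" for N
  proof (rule mean_onI)
    fix f g :: "nat \<Rightarrow> real" and a b :: real
    show "c N (\<lambda>x. a * f x + b * g x) = a * c N f + b * c N g"
      unfolding c_def sum.distrib sum_distrib_left[symmetric] add_divide_distrib times_divide_eq_right ..
  next
    show "c N (\<lambda>_. 1) = 1" by (simp add: c_def)
  next
    fix f :: "nat \<Rightarrow> real" assume "\<And>x. x \<in> UNIV \<Longrightarrow> 0 \<le> f x"
    then show "0 \<le> c N f" unfolding c_def by (intro divide_nonneg_nonneg sum_nonneg) auto
  next
    fix f g :: "nat \<Rightarrow> real" assume "\<And>x. x \<in> UNIV \<Longrightarrow> f x = g x"
    then show "c N f = c N g" by (simp add: c_def)
  qed
  show thesis
  proof (rule that[of "\<lambda>f. Lim U (\<lambda>N. c N f)"])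
    show "mean_on UNIV (\<lambda>f. Lim U (\<lambda>N. c N f))"
      by (rule mean_on_Lim(1)[OF U(1,3) c])
    fix f :: "nat \<Rightarrow> real" assume f: "bounded (range f)"
    then obtain C where C: "\<And>n. \<bar>f n\<bar> \<le> C" by (auto simp: bounded_iff)
    have "c N (\<lambda>n. f (Suc n)) - c N f = (f (Suc N) - f 0) / real (Suc N)" for N
      unfolding c_def diff_divide_distrib[symmetric] sum_subtractf[symmetric]
      using sum_lessThan_telescope[of f "Suc N"] by simp
    then have b1: "\<bar>c N (\<lambda>n. f (Suc n)) - c N f\<bar> \<le> 2 * C / real (Suc N)" for N
      using C[of "Suc N"] C[of 0] by (simp add: divide_right_mono abs_divide)
    have b2: "(\<lambda>N. 2 * C / real (Suc N)) \<longlonglongrightarrow> 0"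
      using tendsto_mult[OF tendsto_const LIMSEQ_inverse_real_of_nat, of "2 * C"]
      by (simp add: divide_inverse)
    have "(\<lambda>N. c N (\<lambda>n. f (Suc n)) - c N f) \<longlonglongrightarrow> 0"
      by (rule Lim_null_comparison[OF _ b2]) (simp only: real_norm_def b1 eventually_True)
    then have *: "((\<lambda>N. c N (\<lambda>n. f (Suc n)) - c N f) \<longlongrightarrow> 0) U"
      by (rule tendsto_mono[OF U(2)])
    have f': "bounded (range (\<lambda>n. f (Suc n)))" using C by (auto simp: bounded_iff)
    have "((\<lambda>N. c N (\<lambda>n. f (Suc n)) - c N f) \<longlongrightarrow>
        Lim U (\<lambda>N. c N (\<lambda>n. f (Suc n))) - Lim U (\<lambda>N. c N f)) U"
      by (intro tendsto_diff mean_on_Lim(2)[OF U(1,3) c] f f')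
    from tendsto_unique[OF U(1) * this]
    show "Lim U (\<lambda>N. c N (\<lambda>n. f (Suc n))) = Lim U (\<lambda>N. c N f)" by simp
  qed
qed

section \<open>Exchanging a mean with an integral over a discrete distribution\<close>

lemma pmf_integrable_bounded:
  fixes f :: "'a \<Rightarrow> real"
  assumes "\<And>x. \<bar>f x\<bar> \<le> C"
  shows "integrable (measure_pmf p) f"
  using assms by (intro measure_pmf.integrable_const_bound[of _ C]) auto

text \<open>A mean is only finitely additive, so the exchange needs an argument: it holds for the
  truncation to a finite set by linearity, and the truncation error is uniform in \<open>i\<close>
  and tends to 0.\<close>

lemma mean_on_pmf_integral_commute:
  fixes p :: "'a::countable pmf" and b :: "'i \<Rightarrow> 'a \<Rightarrow> real"
  assumes m: "mean_on UNIV m" and C: "\<And>i s. \<bar>b i s\<bar> \<le> C"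
  shows "m (\<lambda>i. \<integral>s. b i s \<partial>measure_pmf p) = (\<integral>s. m (\<lambda>i. b i s) \<partial>measure_pmf p)"
proof -
  \<comment> \<open>Finite sets exhausting the countable type; \<open>e n\<close> is the mass
    outside them.\<close>
  define T where "T n = {x :: 'a. to_nat x < n}" for n
  define e where "e n = measure_pmf.prob p (- T n)" for n
  have finT: "finite (T n)" for n
    unfolding T_def by (rule finite_imageD[of to_nat]) (auto intro: finite_subset[of _ "{..<n}"] inj_onI)
  have "(\<lambda>n. measure_pmf.prob p (- T n)) \<longlonglongrightarrow> measure_pmf.prob p (\<Inter>n. - T n)"
    by (rule measure_pmf.finite_Lim_measure_decseq) (auto simp: decseq_def T_def)
  moreover have "(\<Inter>n. - T n) = {}" by (auto simp: T_def)
  ultimately have e: "e \<longlonglongrightarrow> 0" unfolding e_def by simp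
  \<comment> \<open>The estimate is used on both sides: for each integrand \<open>b i\<close>, and
    for the averaged integrand, which satisfies the same bound \<open>C\<close>.\<close>
  have trunc: "\<bar>(\<integral>s. f s \<partial>measure_pmf p) - (\<Sum>s\<in>T n. pmf p s * f s)\<bar> \<le> C * e n"
    if f: "\<And>s. \<bar>f s\<bar> \<le> C" for f n
  proof -
    have C0: "0 \<le> C" using f[of undefined] by linarith
    have "(\<Sum>s\<in>T n. pmf p s * f s) = (\<integral>s. f s * indicator (T n) s \<partial>measure_pmf p)"
      by (subst integral_measure_pmf_real[OF finT, of p _ n])
        (auto simp: indicator_def mult.commute split: if_splits)
    then have "(\<integral>s. f s \<partial>measure_pmf p) - (\<Sum>s\<in>T n. pmf p s * f s) =
        (\<integral>s. f s - f s * indicator (T n) s \<partial>measure_pmf p)"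
      using f C0 by (subst Bochner_Integration.integral_diff)
        (auto intro!: pmf_integrable_bounded[of _ C] simp: indicator_def)
    also have "\<bar>\<dots>\<bar> \<le> (\<integral>s. C * indicator (- T n) s \<partial>measure_pmf p)"
    proof (intro order_trans[OF integral_abs_bound] integral_mono)
      show "integrable (measure_pmf p) (\<lambda>s. \<bar>f s - f s * indicator (T n) s\<bar>)"
        by (rule pmf_integrable_bounded[of _ C]) (use f C0 in \<open>auto simp: indicator_def\<close>)
      show "integrable (measure_pmf p) (\<lambda>s. C * indicator (- T n) s)"
        by (rule pmf_integrable_bounded[of _ C]) (use C0 in \<open>auto simp: indicator_def\<close>)
    qed (use f C0 in \<open>auto simp: indicator_def\<close>)
    finally show ?thesis by (simp add: e_def)
  qed
  have bnd: "bounded (range (\<lambda>i. b i s))" for s using C by (auto simp: bounded_iff)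
  have mb: "\<bar>m (\<lambda>i. b i s)\<bar> \<le> C" for s using C by (intro mean_on_abs_le[OF m])
  have "\<bar>m (\<lambda>i. \<integral>s. b i s \<partial>measure_pmf p) - (\<integral>s. m (\<lambda>i. b i s) \<partial>measure_pmf p)\<bar> \<le> 2 * C * e n" for n
  proof -
    let ?I = "\<lambda>i. \<integral>s. b i s \<partial>measure_pmf p" and ?S = "\<lambda>i. \<Sum>s\<in>T n. pmf p s * b i s"
    have C0: "0 \<le> C" using C[of undefined undefined] by linarith
    have I: "\<bar>?I i\<bar> \<le> C" for i
      using C by (intro order_trans[OF integral_abs_bound] measure_pmf.integral_le_const)
        (auto intro!: pmf_integrable_bounded[of _ C])
    have "\<bar>?S i\<bar> \<le> C + C * e n" for i using trunc[of "b i" n, OF C] I[of i] by linarith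
    then have bS: "bounded (range ?S)" by (auto simp: bounded_iff)
    have bI: "bounded (range ?I)" using I by (auto simp: bounded_iff)
    have "\<bar>m ?I - m ?S\<bar> \<le> C * e n"
      unfolding mean_on_diff[OF m bI bS, symmetric] by (rule mean_on_abs_le[OF m]) (rule trunc[OF C])
    moreover have "m ?S = (\<Sum>s\<in>T n. pmf p s * m (\<lambda>i. b i s))"
      by (rule mean_on_sum[OF m finT bnd])
    ultimately show ?thesis using trunc[of "\<lambda>s. m (\<lambda>i. b i s)" n, OF mb] by linarith
  qed
  moreover have "(\<lambda>n. 2 * C * e n) \<longlonglongrightarrow> 2 * C * 0" by (intro tendsto_intros e)
  ultimately have "\<bar>m (\<lambda>i. \<integral>s. b i s \<partial>measure_pmf p) - (\<integral>s. m (\<lambda>i. b i s) \<partial>measure_pmf p)\<bar> \<le> 2 * C * 0"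
    by (intro LIMSEQ_le_const) auto
  then show ?thesis by simp
qed

section \<open>Amenability of subgroups\<close>

text \<open>Choose a representative \<open>r x\<close> of each right coset of \<open>H\<close> and
  take \<open>x \<otimes> inv (r x)\<close>; left multiplication by \<open>H\<close> keeps the
  coset, hence the representative. Composition with this map turns functions on \<open>H\<close>
  into functions on the group.\<close>

lemma (in group) exists_left_equivariant_retraction:
  assumes H: "subgroup H G"
  obtains \<rho> where "\<And>x. x \<in> carrier G \<Longrightarrow> \<rho> x \<in> H"
    "\<And>h x. h \<in> H \<Longrightarrow> x \<in> carrier G \<Longrightarrow> \<rho> (h \<otimes> x) = h \<otimes> \<rho> x"
proof -
  interpret H: subgroup H G by fact
  define r where "r x = (SOME y. y \<in> H #> x)" for x
  have r: "r x \<in> H #> x" if "x \<in> carrier G" for x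
    unfolding r_def using rcos_self[OF that H] by (rule someI)
  have rc: "r x \<in> carrier G" if "x \<in> carrier G" for x
    using r[OF that] that H.rcosets_carrier by (auto simp: r_coset_def)
  show thesis
  proof (rule that[of "\<lambda>x. x \<otimes> inv (r x)"])
    fix x assume x: "x \<in> carrier G"
    then obtain h where h: "h \<in> H" "r x = h \<otimes> x" using r by (auto simp: r_coset_def)
    then have "x \<otimes> inv (r x) = inv h"
      using x by (simp add: inv_mult_group m_assoc[symmetric])
    then show "x \<otimes> inv (r x) \<in> H" using h by simp
  next
    fix h x assume h: "h \<in> H" and x: "x \<in> carrier G"
    have "H #> (h \<otimes> x) = H #> x"
      using h x by (intro repr_independence[symmetric] H) (auto simp: r_coset_def)
    then have "r (h \<otimes> x) = r x" by (simp add: r_def)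
    then show "h \<otimes> x \<otimes> inv (r (h \<otimes> x)) = h \<otimes> (x \<otimes> inv (r x))"
      using h x rc by (simp add: m_assoc)
  qed
qed

text \<open>Means on the whole group, each invariant under one finite set, suffice: a limit along a
  filter finer than that of finite subsets is invariant under all of \<open>H\<close>, and the
  equivariant retraction transports it to a mean on \<open>H\<close>.\<close>

lemma (in group) amenable_subgroupI:
  assumes H: "subgroup H G"
    and fin: "\<And>S. finite S \<Longrightarrow> S \<subseteq> H \<Longrightarrow> \<exists>m. mean_on (carrier G) m \<and>
      (\<forall>h\<in>S. \<forall>f. bounded (f ` carrier G) \<longrightarrow> m (\<lambda>x. f (h \<otimes> x)) = m f)"
  shows "amenable_subgroup G H"
proof -
  interpret H: subgroup H G by fact
  \<comment> \<open>The choice is made total in \<open>S\<close>: an index that is not a finite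
    subset of \<open>H\<close> gets the mean supplied for the empty set, so
    \<open>mean_on_Lim\<close> applies to the whole family.\<close>
  have "\<exists>m. mean_on (carrier G) m \<and> (finite S \<and> S \<subseteq> H \<longrightarrow>
      (\<forall>h\<in>S. \<forall>f. bounded (f ` carrier G) \<longrightarrow> m (\<lambda>x. f (h \<otimes> x)) = m f))" for S
  proof (cases "finite S \<and> S \<subseteq> H")
    case True
    then show ?thesis using fin[of S] by blast
  next
    case False
    then show ?thesis using fin[of "{}"] by blast
  qed
  then obtain m where m: "\<And>S. mean_on (carrier G) (m S)"
    and minv: "\<And>S h f. finite S \<Longrightarrow> S \<subseteq> H \<Longrightarrow> h \<in> S \<Longrightarrow> bounded (f ` carrier G)
      \<Longrightarrow> m S (\<lambda>x. f (h \<otimes> x)) = m S f"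
    by metis
  obtain U :: "'a set filter" where U: "U \<noteq> bot" "U \<le> finite_subsets_at_top H"
    "\<And>f :: 'a set \<Rightarrow> real. bounded (range f) \<Longrightarrow> (f \<longlongrightarrow> Lim U f) U"
    using exists_bounded_convergence_filter[OF finite_subsets_at_top_neq_bot] by blast
  define M where "M f = Lim U (\<lambda>S. m S f)" for f
  have M: "mean_on (carrier G) M"
    unfolding M_def by (rule mean_on_Lim(1)[OF U(1,3) m])
  have Minv: "M (\<lambda>x. f (h \<otimes> x)) = M f" if f: "bounded (f ` carrier G)" and h: "h \<in> H" for f h
  proof -
    \<comment> \<open>All finite sets beyond \<open>{h}\<close> contain \<open>h\<close>, so
      invariance under \<open>h\<close> holds eventually.\<close>
    have "eventually (\<lambda>S. m S f = m S (\<lambda>x. f (h \<otimes> x))) (finite_subsets_at_top H)"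
      unfolding eventually_finite_subsets_at_top using h f
      by (intro exI[of _ "{h}"]) (auto intro: minv[symmetric])
    then have "eventually (\<lambda>S. m S f = m S (\<lambda>x. f (h \<otimes> x))) U"
      by (rule filter_leD[OF U(2)])
    moreover have "((\<lambda>S. m S f) \<longlongrightarrow> M f) U"
      unfolding M_def by (rule mean_on_Lim(2)[OF U(1,3) m f])
    ultimately have "((\<lambda>S. m S (\<lambda>x. f (h \<otimes> x))) \<longlongrightarrow> M f) U"
      by (simp add: tendsto_cong)
    then show ?thesis unfolding M_def[of "\<lambda>x. f (h \<otimes> x)"] by (rule tendsto_Lim[OF U(1)])
  qed
  obtain \<rho> where \<rho>: "\<And>x. x \<in> carrier G \<Longrightarrow> \<rho> x \<in> H"
    "\<And>h x. h \<in> H \<Longrightarrow> x \<in> carrier G \<Longrightarrow> \<rho> (h \<otimes> x) = h \<otimes> \<rho> x"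
    using exists_left_equivariant_retraction[OF H] by blast
  have bnd: "bounded ((\<lambda>x. f (\<rho> x)) ` carrier G)" if "bounded (f ` H)" for f :: "'a \<Rightarrow> real"
    using \<rho>(1) by (intro bounded_subset[OF that]) auto
  define n where "n f = M (\<lambda>x. f (\<rho> x))" for f
  have n: "mean_on H n"
  proof (rule mean_onI)
    fix f g :: "'a \<Rightarrow> real" assume "\<And>x. x \<in> H \<Longrightarrow> f x = g x"
    then show "n f = n g" unfolding n_def using \<rho>(1) by (intro mean_on_cong[OF M]) auto
  next
    fix f g :: "'a \<Rightarrow> real" and a b :: real
    assume "bounded (f ` H)" "bounded (g ` H)"
    then show "n (\<lambda>x. a * f x + b * g x) = a * n f + b * n g"
      unfolding n_def by (intro mean_on_linear[OF M] bnd)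
  next
    fix f :: "'a \<Rightarrow> real" assume "bounded (f ` H)" "\<And>x. x \<in> H \<Longrightarrow> 0 \<le> f x"
    then show "0 \<le> n f" unfolding n_def using \<rho>(1) by (intro mean_on_nonneg[OF M] bnd) auto
  next
    show "n (\<lambda>_. 1) = 1" unfolding n_def by (rule mean_on_one[OF M])
  qed
  have "n (\<lambda>x. f (h \<otimes> x)) = n f" if f: "bounded (f ` H)" and h: "h \<in> H" for f h
  proof -
    have "n (\<lambda>x. f (h \<otimes> x)) = M (\<lambda>x. f (\<rho> (h \<otimes> x)))"
      unfolding n_def using \<rho>(2)[OF h] by (intro mean_on_cong[OF M]) simp
    also have "\<dots> = n f" unfolding n_def by (rule Minv[OF bnd[OF f] h])
    finally show ?thesis .
  qed
  with n H show ?thesis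
    unfolding amenable_subgroup_def mean_on_def by (intro conjI exI[of _ n]) auto
qed

section \<open>Harmonic functions along the random walk\<close>

locale random_walk = group G for G :: "('a::countable, 'b) monoid_scheme" (structure) +
  fixes \<mu> :: "'a pmf"
  assumes generating: "generating G \<mu>"
begin

sublocale inc: sequence_space "measure_pmf \<mu>"
  by unfold_locales

abbreviation \<Omega> :: "(nat \<Rightarrow> 'a) measure" where
  "\<Omega> \<equiv> PiM UNIV (\<lambda>_. measure_pmf \<mu>)"

lemma set_pmf_carrier: "s \<in> set_pmf \<mu> \<Longrightarrow> s \<in> carrier G"
  using generating by (auto simp: generating_def)

lemma space_\<Omega> [simp]: "space \<Omega> = UNIV"
  by (simp add: space_PiM)

lemma space_path_space [simp]: "space path_space = UNIV"
  by (simp add: path_space_def space_PiM)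

lemma measurable_increment [measurable]: "(\<lambda>\<omega>. \<omega> n) \<in> measurable \<Omega> (count_space UNIV)"
  using measurable_component_singleton[of n UNIV "\<lambda>_. measure_pmf \<mu>"]
  by (subst measurable_cong_sets[OF refl, of _ "measure_pmf \<mu>"]) auto

lemma measurable_walk [measurable]: "(\<lambda>\<omega>. walk G \<omega> n) \<in> measurable \<Omega> (count_space UNIV)"
proof (induction n)
  case (Suc n)
  have "(\<lambda>\<omega>. x \<otimes> \<omega> (Suc n)) \<in> measurable \<Omega> (count_space UNIV)" for x
    by (rule measurable_compose[OF measurable_increment]) simp
  from measurable_compose_countable[OF this Suc.IH] show ?case by simp
qed simp

lemma borel_measurable_walk [measurable]: "(\<lambda>\<omega>. f (walk G \<omega> n)) \<in> borel_measurable \<Omega>"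
  by (rule measurable_compose[OF measurable_walk]) simp

lemma measurable_path [measurable]:
  "(\<lambda>\<omega>. path_act G g (walk G \<omega>)) \<in> measurable \<Omega> path_space"
  unfolding path_space_def path_act_def
  by (rule measurable_PiM_single') (auto intro: measurable_compose[OF measurable_walk])

lemma measurable_walk_path [measurable]: "walk G \<in> measurable \<Omega> path_space"
  unfolding path_space_def by (rule measurable_PiM_single') (auto intro: measurable_walk)

lemma integrable_\<Omega>_bounded:
  fixes f :: "(nat \<Rightarrow> 'a) \<Rightarrow> real"
  assumes "f \<in> borel_measurable \<Omega>" "\<And>\<omega>. \<bar>f \<omega>\<bar> \<le> C"
  shows "integrable \<Omega> f"
  using assms by (intro inc.P.integrable_const_bound[of _ C]) auto

lemma AE_increments_carrier: "AE \<omega> in \<Omega>. \<forall>n. \<omega> n \<in> carrier G"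
  unfolding AE_all_countable
  by (intro allI AE_PiM_component) (auto simp: AE_measure_pmf_iff set_pmf_carrier measure_pmf.prob_space_axioms)

lemma walk_closed: "(\<And>n. \<omega> n \<in> carrier G) \<Longrightarrow> walk G \<omega> n \<in> carrier G"
  by (induction n) auto

text \<open>The walk already uses one increment at index 0, so prepending an increment delays time
  by exactly one.\<close>

lemma walk_case_nat:
  assumes "s \<in> carrier G" "\<And>n. \<omega> n \<in> carrier G"
  shows "walk G (case_nat s \<omega>) (Suc n) = s \<otimes> walk G \<omega> n"
  using assms by (induction n) (auto simp: m_assoc walk_closed)

lemma walk_comb_seq_less: "n < i \<Longrightarrow> walk G (comb_seq i \<omega> \<omega>') n = walk G \<omega> n"
  by (induction n) (auto simp: comb_seq_def)

text \<open>\<open>comb_seq (Suc i)\<close> keeps the increments 0 to i, exactly those used by the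
  walk at time \<open>i\<close>; from there a fresh walk continues.\<close>

lemma walk_comb_seq:
  assumes "\<And>n. \<omega> n \<in> carrier G" "\<And>n. \<omega>' n \<in> carrier G"
  shows "walk G (comb_seq (Suc i) \<omega> \<omega>') (Suc i + n) = walk G \<omega> i \<otimes> walk G \<omega>' n"
  using assms by (induction n) (auto simp: m_assoc walk_closed walk_comb_seq_less comb_seq_def)

text \<open>First-step analysis: prepending an independent increment preserves the product law, and
  Fubini separates it from the rest.\<close>

lemma integral_case_nat:
  fixes f :: "(nat \<Rightarrow> 'a) \<Rightarrow> real"
  assumes f [measurable]: "f \<in> borel_measurable \<Omega>" and C: "\<And>\<omega>. \<bar>f \<omega>\<bar> \<le> C"
  shows "(\<integral>\<omega>. f \<omega> \<partial>\<Omega>) = (\<integral>s. \<integral>\<omega>. f (case_nat s \<omega>) \<partial>\<Omega> \<partial>measure_pmf \<mu>)"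
proof -
  interpret pair_prob_space "measure_pmf \<mu>" \<Omega> ..
  have "(\<integral>\<omega>. f \<omega> \<partial>\<Omega>) = (\<integral>\<omega>. f \<omega> \<partial>distr (measure_pmf \<mu> \<Otimes>\<^sub>M \<Omega>) \<Omega> (\<lambda>(s, \<omega>). case_nat s \<omega>))"
    by (simp only: inc.PiM_iter)
  also have "\<dots> = (\<integral>(s, \<omega>). f (case_nat s \<omega>) \<partial>(measure_pmf \<mu> \<Otimes>\<^sub>M \<Omega>))"
    by (subst integral_distr) (auto simp: case_prod_unfold)
  also have "\<dots> = (\<integral>s. \<integral>\<omega>. f (case_nat s \<omega>) \<partial>\<Omega> \<partial>measure_pmf \<mu>)"
    by (rule integral_fst[symmetric])
      (auto intro!: P.integrable_const_bound[of _ C] simp: case_prod_unfold C)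
  finally show ?thesis .
qed

text \<open>The same for \<open>i\<close> increments at once. The inner integral acts as the
  conditional expectation given the first \<open>i\<close> increments.\<close>

lemma integral_comb_seq:
  fixes f :: "(nat \<Rightarrow> 'a) \<Rightarrow> real"
  assumes f [measurable]: "f \<in> borel_measurable \<Omega>" and C: "\<And>\<omega>. \<bar>f \<omega>\<bar> \<le> C"
  shows "(\<integral>\<omega>. f \<omega> \<partial>\<Omega>) = (\<integral>\<omega>. \<integral>\<omega>'. f (comb_seq i \<omega> \<omega>') \<partial>\<Omega> \<partial>\<Omega>)"
    and "(\<lambda>\<omega>. \<integral>\<omega>'. f (comb_seq i \<omega> \<omega>') \<partial>\<Omega>) \<in> borel_measurable \<Omega>"
proof -
  interpret pair_prob_space \<Omega> \<Omega> ..
  have "(\<integral>\<omega>. f \<omega> \<partial>\<Omega>) = (\<integral>\<omega>. f \<omega> \<partial>distr (\<Omega> \<Otimes>\<^sub>M \<Omega>) \<Omega> (\<lambda>(\<omega>, \<omega>'). comb_seq i \<omega> \<omega>'))"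
    by (simp only: inc.PiM_comb_seq)
  also have "\<dots> = (\<integral>(\<omega>, \<omega>'). f (comb_seq i \<omega> \<omega>') \<partial>(\<Omega> \<Otimes>\<^sub>M \<Omega>))"
    by (subst integral_distr) (auto simp: case_prod_unfold)
  also have "\<dots> = (\<integral>\<omega>. \<integral>\<omega>'. f (comb_seq i \<omega> \<omega>') \<partial>\<Omega> \<partial>\<Omega>)"
    by (rule integral_fst[symmetric])
      (auto intro!: P.integrable_const_bound[of _ C] simp: case_prod_unfold C)
  finally show "(\<integral>\<omega>. f \<omega> \<partial>\<Omega>) = (\<integral>\<omega>. \<integral>\<omega>'. f (comb_seq i \<omega> \<omega>') \<partial>\<Omega> \<partial>\<Omega>)" .
  show "(\<lambda>\<omega>. \<integral>\<omega>'. f (comb_seq i \<omega> \<omega>') \<partial>\<Omega>) \<in> borel_measurable \<Omega>"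
    by measurable
qed

lemma integral_increment_zero:
  fixes f :: "'a \<Rightarrow> real"
  assumes "\<And>s. \<bar>f s\<bar> \<le> C"
  shows "(\<integral>\<omega>. f (\<omega> 0) \<partial>\<Omega>) = (\<integral>s. f s \<partial>measure_pmf \<mu>)"
  by (subst integral_case_nat[of _ C])
    (auto intro!: measurable_compose[OF measurable_increment] assms simp: inc.P.prob_space[unfolded space_\<Omega>])

section \<open>Bounded harmonic functions: martingale property and almost sure convergence\<close>

definition harmonic :: "('a \<Rightarrow> real) \<Rightarrow> bool" where
  "harmonic w \<longleftrightarrow> (\<forall>g\<in>carrier G. w g = (\<integral>s. w (g \<otimes> s) \<partial>measure_pmf \<mu>))"

text \<open>Bounded functions of the increments up to index \<open>k\<close>. Stating the dependence
  on coordinates directly replaces a filtration, and testing against such functions replaces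
  conditional expectations.\<close>

definition adapted :: "nat \<Rightarrow> ((nat \<Rightarrow> 'a) \<Rightarrow> real) \<Rightarrow> bool" where
  "adapted k Z \<longleftrightarrow> Z \<in> borel_measurable \<Omega> \<and> (\<exists>C. \<forall>\<omega>. \<bar>Z \<omega>\<bar> \<le> C) \<and>
     (\<forall>\<omega> \<omega>'. (\<forall>j\<le>k. \<omega> j = \<omega>' j) \<longrightarrow> Z \<omega> = Z \<omega>')"

lemma walk_cong: "(\<And>j. j \<le> k \<Longrightarrow> \<omega> j = \<omega>' j) \<Longrightarrow> walk G \<omega> k = walk G \<omega>' k"
  by (induction k) auto

lemma adapted_mono: "adapted k Z \<Longrightarrow> k \<le> n \<Longrightarrow> adapted n Z"
  unfolding adapted_def by (meson le_trans)

text \<open>\<open>Z\<close> and the walk at time \<open>k\<close> use only increments up to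
  \<open>k\<close>. Integrating out the next, independent increment is exactly the mean value
  property of \<open>w\<close>.\<close>

lemma martingale_step:
  assumes Z: "adapted k Z" and w: "harmonic w" and D: "\<And>g. \<bar>w g\<bar> \<le> D"
  shows "(\<integral>\<omega>. Z \<omega> * w (walk G \<omega> (Suc k)) \<partial>\<Omega>) = (\<integral>\<omega>. Z \<omega> * w (walk G \<omega> k) \<partial>\<Omega>)"
proof -
  have Zm [measurable]: "Z \<in> borel_measurable \<Omega>" using Z by (simp add: adapted_def)
  obtain C where C: "\<And>\<omega>. \<bar>Z \<omega>\<bar> \<le> C" using Z by (auto simp: adapted_def)
  have Zcomb: "Z (comb_seq (Suc k) \<omega> \<omega>') = Z \<omega>" for \<omega> \<omega>'
    using Z unfolding adapted_def by (auto simp: comb_seq_def)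
  have bound: "\<bar>Z \<omega> * w (walk G \<omega> (Suc k))\<bar> \<le> C * D" for \<omega>
    unfolding abs_mult using C D by (intro mult_mono) (auto intro: order_trans[OF abs_ge_zero])
  have meas: "(\<lambda>\<omega>. Z \<omega> * w (walk G \<omega> (Suc k))) \<in> borel_measurable \<Omega>" by measurable
  have "(\<integral>\<omega>. Z \<omega> * w (walk G \<omega> (Suc k)) \<partial>\<Omega>) =
      (\<integral>\<omega>. \<integral>\<omega>'. Z (comb_seq (Suc k) \<omega> \<omega>') * w (walk G (comb_seq (Suc k) \<omega> \<omega>') (Suc k)) \<partial>\<Omega> \<partial>\<Omega>)"
    by (rule integral_comb_seq(1)[OF meas bound])
  also have "\<dots> = (\<integral>\<omega>. Z \<omega> * w (walk G \<omega> k) \<partial>\<Omega>)"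
  proof (rule integral_cong_AE)
    show "AE \<omega> in \<Omega>. (\<integral>\<omega>'. Z (comb_seq (Suc k) \<omega> \<omega>') * w (walk G (comb_seq (Suc k) \<omega> \<omega>') (Suc k)) \<partial>\<Omega>)
        = Z \<omega> * w (walk G \<omega> k)"
      using AE_increments_carrier
    proof eventually_elim
      case (elim \<omega>)
      \<comment> \<open>Index \<open>Suc k\<close> is the first one taken from the second sequence,
        hence \<open>\<omega>' 0\<close>.\<close>
      have "walk G (comb_seq (Suc k) \<omega> \<omega>') (Suc k) = walk G \<omega> k \<otimes> \<omega>' 0" for \<omega>'
        by (simp add: walk_comb_seq_less comb_seq_def)
      then have "(\<integral>\<omega>'. Z (comb_seq (Suc k) \<omega> \<omega>') * w (walk G (comb_seq (Suc k) \<omega> \<omega>') (Suc k)) \<partial>\<Omega>)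
          = (\<integral>\<omega>'. Z \<omega> * w (walk G \<omega> k \<otimes> \<omega>' 0) \<partial>\<Omega>)"
        by (simp only: Zcomb)
      also have "\<dots> = Z \<omega> * (\<integral>s. w (walk G \<omega> k \<otimes> s) \<partial>measure_pmf \<mu>)"
        using integral_increment_zero[of "\<lambda>s. w (walk G \<omega> k \<otimes> s)", OF D] by simp
      also have "(\<integral>s. w (walk G \<omega> k \<otimes> s) \<partial>measure_pmf \<mu>) = w (walk G \<omega> k)"
        using w walk_closed[of \<omega> k] elim unfolding harmonic_def by force
      finally show ?case .
    qed
  qed (use integral_comb_seq(2)[OF meas bound] in measurable)
  finally show ?thesis .
qed

lemma martingale:
  assumes Z: "adapted k Z" and w: "harmonic w" and D: "\<And>g. \<bar>w g\<bar> \<le> D" and kn: "k \<le> n"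
  shows "(\<integral>\<omega>. Z \<omega> * w (walk G \<omega> n) \<partial>\<Omega>) = (\<integral>\<omega>. Z \<omega> * w (walk G \<omega> k) \<partial>\<Omega>)"
  using kn
proof (induction n rule: dec_induct)
  case (step n)
  then show ?case using martingale_step[OF adapted_mono[OF Z] w D, of n] by simp
qed simp

lemma adapted_walk:
  assumes "\<And>g. \<bar>w g\<bar> \<le> D"
  shows "adapted k (\<lambda>\<omega>. w (walk G \<omega> k))"
  unfolding adapted_def
proof (intro conjI allI impI)
  fix \<omega> \<omega>' :: "nat \<Rightarrow> 'a" assume "\<forall>j\<le>k. \<omega> j = \<omega>' j"
  then show "w (walk G \<omega> k) = w (walk G \<omega>' k)" by (intro arg_cong[where f = w] walk_cong) auto
qed (use assms in auto)

text \<open>Orthogonality of martingale increments: by \<open>martingale\<close> the mixed term has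
  the same integral as the square at time \<open>m\<close>.\<close>

lemma integral_harmonic_increment_square:
  assumes w: "harmonic w" and D: "\<And>g. \<bar>w g\<bar> \<le> D" and mn: "m \<le> n"
  shows "(\<integral>\<omega>. (w (walk G \<omega> n) - w (walk G \<omega> m))\<^sup>2 \<partial>\<Omega>) =
    (\<integral>\<omega>. (w (walk G \<omega> n))\<^sup>2 \<partial>\<Omega>) - (\<integral>\<omega>. (w (walk G \<omega> m))\<^sup>2 \<partial>\<Omega>)"
proof -
  have int: "integrable \<Omega> (\<lambda>\<omega>. w (walk G \<omega> i) * w (walk G \<omega> j))" for i j
    using D by (intro integrable_\<Omega>_bounded[of _ "D * D"])
      (auto simp: abs_mult intro!: mult_mono intro: order_trans[OF abs_ge_zero])
  have "(\<integral>\<omega>. w (walk G \<omega> m) * w (walk G \<omega> n) \<partial>\<Omega>) = (\<integral>\<omega>. w (walk G \<omega> m) * w (walk G \<omega> m) \<partial>\<Omega>)"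
    by (rule martingale[OF adapted_walk[OF D] w D mn])
  moreover have "(w (walk G \<omega> n) - w (walk G \<omega> m))\<^sup>2 =
      w (walk G \<omega> n) * w (walk G \<omega> n) - 2 * (w (walk G \<omega> m) * w (walk G \<omega> n))
        + w (walk G \<omega> m) * w (walk G \<omega> m)" for \<omega>
    by (simp add: power2_eq_square algebra_simps)
  ultimately show ?thesis
    by (simp add: int power2_eq_square)
qed

text \<open>Kolmogorov's inequality. The event is split according to the first time the deviation
  from time \<open>m\<close> exceeds \<open>e\<close>; on each piece the later increment is
  orthogonal to the deviation already reached.\<close>

lemma harmonic_maximal_inequality:
  assumes w: "harmonic w" and D: "\<And>g. \<bar>w g\<bar> \<le> D" and mn: "m \<le> n" and e: "0 < e"
  shows "e\<^sup>2 * inc.P.prob {\<omega>. \<exists>k\<in>{m..n}. e < \<bar>w (walk G \<omega> k) - w (walk G \<omega> m)\<bar>} \<le>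
    (\<integral>\<omega>. (w (walk G \<omega> n) - w (walk G \<omega> m))\<^sup>2 \<partial>\<Omega>)"
proof -
  define M where "M k \<omega> = w (walk G \<omega> k)" for k \<omega>
  have [measurable]: "M k \<in> borel_measurable \<Omega>" for k unfolding M_def by measurable
  have MD: "\<bar>M k \<omega>\<bar> \<le> D" for k \<omega> using D by (simp add: M_def)
  have Mdiff: "\<bar>M j \<omega> - M k \<omega>\<bar> \<le> 2 * D" for j k \<omega> using MD[of j \<omega>] MD[of k \<omega>] by linarith
  have D0: "0 \<le> D" using MD[of 0 undefined] by linarith
  have Msq: "(M j \<omega> - M k \<omega>)\<^sup>2 \<le> (2 * D)\<^sup>2" for j k \<omega>
    using power_mono[OF Mdiff[of j \<omega> k], of 2] by simp
  \<comment> \<open>\<open>A k\<close>: time \<open>k\<close> is the first exceedance at or after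
    \<open>m\<close>. These events are disjoint and determined by the increments up to
    \<open>k\<close>.\<close>
  define A where "A k = {\<omega>. e < \<bar>M k \<omega> - M m \<omega>\<bar> \<and> (\<forall>j\<in>{m..<k}. \<bar>M j \<omega> - M m \<omega>\<bar> \<le> e)}" for k
  have "{\<omega> \<in> space \<Omega>. e < \<bar>M k \<omega> - M m \<omega>\<bar> \<and> (\<forall>j\<in>{m..<k}. \<bar>M j \<omega> - M m \<omega>\<bar> \<le> e)} \<in> sets \<Omega>" for k
    by measurable
  then have Am [measurable]: "A k \<in> sets \<Omega>" for k by (simp add: A_def)
  have disj: "disjoint_family_on A {m..n}"
  proof -
    have "A i \<inter> A j = {}" if "m \<le> i" "i < j" for i j
      using that by (auto simp: A_def not_le dest!: bspec[of _ _ i])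
    then show ?thesis unfolding disjoint_family_on_def
      by (metis Int_commute atLeastAtMost_iff linorder_neqE_nat)
  qed
  have un: "{\<omega>. \<exists>k\<in>{m..n}. e < \<bar>w (walk G \<omega> k) - w (walk G \<omega> m)\<bar>} = (\<Union>k\<in>{m..n}. A k)"
  proof (intro Set.set_eqI iffI)
    fix \<omega> assume "\<omega> \<in> {\<omega>. \<exists>k\<in>{m..n}. e < \<bar>w (walk G \<omega> k) - w (walk G \<omega> m)\<bar>}"
    then obtain k where k: "m \<le> k" "k \<le> n" "e < \<bar>M k \<omega> - M m \<omega>\<bar>" by (auto simp: M_def)
    define l where "l = (LEAST k. m \<le> k \<and> e < \<bar>M k \<omega> - M m \<omega>\<bar>)"
    have l: "m \<le> l" "e < \<bar>M l \<omega> - M m \<omega>\<bar>"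
      using LeastI[of "\<lambda>k. m \<le> k \<and> e < \<bar>M k \<omega> - M m \<omega>\<bar>" k] k by (auto simp: l_def)
    have "l \<le> k" using k by (auto simp: l_def intro: Least_le)
    moreover have "\<bar>M j \<omega> - M m \<omega>\<bar> \<le> e" if "j \<in> {m..<l}" for j
      using that not_less_Least[of j "\<lambda>k. m \<le> k \<and> e < \<bar>M k \<omega> - M m \<omega>\<bar>"] by (auto simp: l_def)
    ultimately show "\<omega> \<in> (\<Union>k\<in>{m..n}. A k)" using l k by (auto simp: A_def)
  qed (auto simp: A_def M_def)
  have intI: "integrable \<Omega> (\<lambda>\<omega>. indicator (A k) \<omega> * (M n \<omega> - M m \<omega>)\<^sup>2)" for k
    by (rule integrable_\<Omega>_bounded[of _ "(2 * D)\<^sup>2"])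
      (use Msq in \<open>auto simp: indicator_def simp del: power_mult_distrib\<close>)
  have piece: "e\<^sup>2 * inc.P.prob (A k) \<le> (\<integral>\<omega>. indicator (A k) \<omega> * (M n \<omega> - M m \<omega>)\<^sup>2 \<partial>\<Omega>)"
    if k: "k \<in> {m..n}" for k
  proof -
    \<comment> \<open>Coefficient of the mixed term when the square of M n - M m is expanded around
      M k. It is adapted, so the mixed term integrates to 0.\<close>
    define Z where "Z \<omega> = 2 * (indicator (A k) \<omega> * (M k \<omega> - M m \<omega>))" for \<omega>
    have ZC: "\<bar>Z \<omega>\<bar> \<le> 4 * D" for \<omega>
      using Mdiff[of k \<omega> m] D0 by (auto simp: Z_def indicator_def)
    have Z: "adapted k Z" unfolding adapted_def
    proof (intro conjI allI impI)
      show "Z \<in> borel_measurable \<Omega>" unfolding Z_def by measurable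
      show "\<exists>C. \<forall>\<omega>. \<bar>Z \<omega>\<bar> \<le> C" using ZC by blast
      fix \<omega> \<omega>' :: "nat \<Rightarrow> 'a" assume eq: "\<forall>j\<le>k. \<omega> j = \<omega>' j"
      have "M j \<omega> = M j \<omega>'" if "j \<le> k" for j
        unfolding M_def using eq that by (intro arg_cong[where f = w] walk_cong) auto
      then show "Z \<omega> = Z \<omega>'" using k by (auto simp: Z_def A_def indicator_def)
    qed
    have intZ: "integrable \<Omega> (\<lambda>\<omega>. Z \<omega> * M j \<omega>)" for j
      using ZC MD D0 Z by (intro integrable_\<Omega>_bounded[of _ "4 * D * D"])
        (auto simp: abs_mult adapted_def intro!: mult_mono)
    have intA: "integrable \<Omega> (indicat_real (A k))"
      by (rule integrable_\<Omega>_bounded[of _ 1]) (auto simp: indicator_def)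
    have "(\<integral>\<omega>. Z \<omega> * M n \<omega> \<partial>\<Omega>) = (\<integral>\<omega>. Z \<omega> * M k \<omega> \<partial>\<Omega>)"
      unfolding M_def using k by (intro martingale[OF Z w D]) auto
    then have orth: "(\<integral>\<omega>. Z \<omega> * M n \<omega> - Z \<omega> * M k \<omega> \<partial>\<Omega>) = 0"
      using intZ by simp
    have "e\<^sup>2 * inc.P.prob (A k) = (\<integral>\<omega>. e\<^sup>2 * indicator (A k) \<omega> + (Z \<omega> * M n \<omega> - Z \<omega> * M k \<omega>) \<partial>\<Omega>)"
      using intZ orth intA by (subst Bochner_Integration.integral_add) auto
    \<comment> \<open>On \<open>A k\<close> the square of M k - M m is at least e^2, the square of M
      n - M k is dropped, and the mixed term is the integrand that was added above.\<close>
    also have "\<dots> \<le> (\<integral>\<omega>. indicator (A k) \<omega> * (M n \<omega> - M m \<omega>)\<^sup>2 \<partial>\<Omega>)"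
    proof (rule integral_mono)
      fix \<omega>
      have "e\<^sup>2 \<le> (M k \<omega> - M m \<omega>)\<^sup>2 + (M n \<omega> - M k \<omega>)\<^sup>2" if "\<omega> \<in> A k"
      proof (rule add_increasing2)
        show "e\<^sup>2 \<le> (M k \<omega> - M m \<omega>)\<^sup>2"
          using that e by (auto simp: A_def abs_le_square_iff[symmetric])
      qed simp
      moreover have "(M n \<omega> - M m \<omega>)\<^sup>2 = (M k \<omega> - M m \<omega>)\<^sup>2 + (M n \<omega> - M k \<omega>)\<^sup>2
          + 2 * (M k \<omega> - M m \<omega>) * (M n \<omega> - M k \<omega>)"
        by (simp add: power2_eq_square algebra_simps)
      ultimately show "e\<^sup>2 * indicator (A k) \<omega> + (Z \<omega> * M n \<omega> - Z \<omega> * M k \<omega>)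
          \<le> indicator (A k) \<omega> * (M n \<omega> - M m \<omega>)\<^sup>2"
        by (auto simp: Z_def indicator_def right_diff_distrib)
    qed (use intI intZ intA in auto)
    finally show ?thesis .
  qed
  have "e\<^sup>2 * inc.P.prob (\<Union>k\<in>{m..n}. A k) = (\<Sum>k\<in>{m..n}. e\<^sup>2 * inc.P.prob (A k))"
    using disj by (subst inc.P.finite_measure_finite_Union) (auto simp: sum_distrib_left)
  also have "\<dots> \<le> (\<Sum>k\<in>{m..n}. \<integral>\<omega>. indicator (A k) \<omega> * (M n \<omega> - M m \<omega>)\<^sup>2 \<partial>\<Omega>)"
    by (rule sum_mono) (rule piece)
  also have "\<dots> = (\<integral>\<omega>. (\<Sum>k\<in>{m..n}. indicator (A k) \<omega>) * (M n \<omega> - M m \<omega>)\<^sup>2 \<partial>\<Omega>)"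
    unfolding sum_distrib_right by (rule Bochner_Integration.integral_sum[symmetric]) (rule intI)
  also have "\<dots> \<le> (\<integral>\<omega>. (M n \<omega> - M m \<omega>)\<^sup>2 \<partial>\<Omega>)"
  proof (rule integral_mono)
    show "integrable \<Omega> (\<lambda>\<omega>. (\<Sum>k\<in>{m..n}. indicator (A k) \<omega>) * (M n \<omega> - M m \<omega>)\<^sup>2)"
      unfolding sum_distrib_right by (intro Bochner_Integration.integrable_sum intI)
    show "integrable \<Omega> (\<lambda>\<omega>. (M n \<omega> - M m \<omega>)\<^sup>2)"
      by (rule integrable_\<Omega>_bounded[of _ "(2 * D)\<^sup>2"])
        (use Msq in \<open>auto simp del: power_mult_distrib\<close>)
    fix \<omega>
    have "(\<Sum>k\<in>{m..n}. indicator (A k) \<omega>) = (indicator (\<Union>k\<in>{m..n}. A k) \<omega> :: real)"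
      by (rule indicator_UN_disjoint[symmetric]) (use disj in auto)
    also have "\<dots> \<le> 1" by (simp add: indicator_def)
    finally show "(\<Sum>k\<in>{m..n}. indicator (A k) \<omega>) * (M n \<omega> - M m \<omega>)\<^sup>2 \<le> (M n \<omega> - M m \<omega>)\<^sup>2"
      by (intro mult_left_le_one_le) (auto intro: sum_nonneg)
  qed
  finally show ?thesis unfolding un by (simp add: M_def)
qed

text \<open>The second moments \<open>a n\<close> increase to a finite limit \<open>l\<close>. By
  the maximal inequality an oscillation above \<open>e\<close> after time \<open>m\<close> has
  probability at most (l - a m)/e^2, so almost every trajectory is Cauchy.\<close>

lemma harmonic_AE_convergent:
  assumes w: "harmonic w" and D: "\<And>g. \<bar>w g\<bar> \<le> D"
  shows "AE \<omega> in \<Omega>. convergent (\<lambda>n. w (walk G \<omega> n))"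
proof -
  define M where "M k \<omega> = w (walk G \<omega> k)" for k \<omega>
  have [measurable]: "M k \<in> borel_measurable \<Omega>" for k unfolding M_def by measurable
  define a where "a n = (\<integral>\<omega>. (M n \<omega>)\<^sup>2 \<partial>\<Omega>)" for n
  have D0: "0 \<le> D" using D[of undefined] by linarith
  have diff: "(\<integral>\<omega>. (M n \<omega> - M m \<omega>)\<^sup>2 \<partial>\<Omega>) = a n - a m" if "m \<le> n" for m n
    unfolding M_def a_def by (rule integral_harmonic_increment_square[OF w D that])
  have "a m \<le> a n" if "m \<le> n" for m n
  proof -
    have "0 \<le> (\<integral>\<omega>. (M n \<omega> - M m \<omega>)\<^sup>2 \<partial>\<Omega>)" by simp
    then show ?thesis using diff[OF that] by simp
  qed
  then have inc_a: "incseq a" by (auto simp: incseq_def)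
  have aD: "a n \<le> D\<^sup>2" for n
    unfolding a_def using D by (intro inc.P.integral_le_const integrable_\<Omega>_bounded[of _ "D\<^sup>2"])
      (auto simp: M_def abs_le_square_iff[symmetric] D0)
  then obtain l where l: "a \<longlonglongrightarrow> l" "\<And>n. a n \<le> l" using incseq_convergent[OF inc_a] by blast
  have small: "AE \<omega> in \<Omega>. \<exists>m. \<forall>k\<ge>m. \<bar>M k \<omega> - M m \<omega>\<bar> \<le> e" if e: "0 < e" for e
  proof -
    define E where "E m n = {\<omega>. \<exists>k\<in>{m..n}. e < \<bar>M k \<omega> - M m \<omega>\<bar>}" for m n
    have "{\<omega> \<in> space \<Omega>. \<exists>k\<in>{m..n}. e < \<bar>M k \<omega> - M m \<omega>\<bar>} \<in> sets \<Omega>" for m n by measurable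
    then have Em [measurable]: "E m n \<in> sets \<Omega>" for m n by (simp add: E_def)
    have bound: "inc.P.prob (E m n) \<le> (l - a m) / e\<^sup>2" for m n
    proof (cases "m \<le> n")
      case True
      have "e\<^sup>2 * inc.P.prob (E m n) \<le> a n - a m"
        using harmonic_maximal_inequality[OF w D True e] diff[OF True] by (simp add: E_def M_def)
      then show ?thesis using l(2)[of n] e by (simp add: field_simps)
    next
      case False
      then show ?thesis using l(2)[of m] by (simp add: E_def)
    qed
    \<comment> \<open>The bound does not involve the horizon \<open>n\<close>, so it survives the
      increasing union; letting \<open>m\<close> grow then makes the event of persistent oscillation
      null.\<close>
    have bU: "inc.P.prob (\<Union>n. E m n) \<le> (l - a m) / e\<^sup>2" for m
    proof (rule LIMSEQ_le_const2)
      show "(\<lambda>n. inc.P.prob (E m n)) \<longlonglongrightarrow> inc.P.prob (\<Union>n. E m n)"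
      proof (rule inc.P.finite_Lim_measure_incseq)
        show "incseq (E m)" unfolding incseq_def E_def by fastforce
      qed auto
    qed (use bound in auto)
    have "inc.P.prob (\<Inter>m. \<Union>n. E m n) \<le> (l - a m) / e\<^sup>2" for m
      by (rule order_trans[OF inc.P.finite_measure_mono bU]) auto
    moreover have "(\<lambda>m. (l - a m) / e\<^sup>2) \<longlonglongrightarrow> (l - l) / e\<^sup>2"
      using e by (intro tendsto_intros l) auto
    ultimately have "inc.P.prob (\<Inter>m. \<Union>n. E m n) \<le> (l - l) / e\<^sup>2"
      by (intro LIMSEQ_le_const) auto
    then have "(\<Inter>m. \<Union>n. E m n) \<in> null_sets \<Omega>"
      by (auto simp: null_sets_def inc.P.emeasure_eq_measure measure_le_0_iff)
    then show ?thesis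
      by (rule AE_I') (force simp: E_def not_le)
  qed
  have "AE \<omega> in \<Omega>. \<forall>j. \<exists>m. \<forall>k\<ge>m. \<bar>M k \<omega> - M m \<omega>\<bar> \<le> 1 / real (Suc j)"
    unfolding AE_all_countable by (intro allI small) simp
  then show ?thesis
  proof eventually_elim
    case (elim \<omega>)
    have "Cauchy (\<lambda>n. M n \<omega>)"
    proof (rule metric_CauchyI)
      fix e :: real assume "0 < e"
      then obtain j where j: "1 / real (Suc j) < e / 2" using nat_approx_posE[of "e / 2"] by auto
      obtain m where m: "\<And>k. k \<ge> m \<Longrightarrow> \<bar>M k \<omega> - M m \<omega>\<bar> \<le> 1 / real (Suc j)" using elim by blast
      have "dist (M k \<omega>) (M k' \<omega>) < e" if "k \<ge> m" "k' \<ge> m" for k k'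
        using m[OF that(1)] m[OF that(2)] j by (simp add: dist_real_def)
      then show "\<exists>m. \<forall>k\<ge>m. \<forall>n\<ge>m. dist (M k \<omega>) (M n \<omega>) < e" by blast
    qed
    then show ?case unfolding M_def by (rule Cauchy_convergent)
  qed
qed

end

section \<open>Shift-invariant events\<close>

lemma shift_invariant_sets_sets: "E \<in> shift_invariant_sets \<Longrightarrow> E \<in> sets path_space"
  by (simp add: shift_invariant_sets_def)

lemma shift_invariant_shift_iff: "E \<in> shift_invariant_sets \<Longrightarrow> shift x \<in> E \<longleftrightarrow> x \<in> E"
  by (auto simp: shift_invariant_sets_def path_space_def space_PiM)

lemma shift_invariant_drop_iff:
  assumes "E \<in> shift_invariant_sets"
  shows "(\<lambda>n. x (k + n)) \<in> E \<longleftrightarrow> x \<in> E"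
proof (induction k)
  case (Suc k)
  have "(\<lambda>n. x (Suc k + n)) = shift (\<lambda>n. x (k + n))" by (simp add: shift_def)
  then show ?case using Suc shift_invariant_shift_iff[OF assms] by simp
qed simp

lemma shift_invariant_setsI:
  assumes "E \<in> sets path_space" "\<And>x. shift x \<in> E \<longleftrightarrow> x \<in> E"
  shows "E \<in> shift_invariant_sets"
  using assms by (auto simp: shift_invariant_sets_def path_space_def space_PiM)

section \<open>Invariant events seen from different starting points: harmonicity, maximum principle,
  zero-one law\<close>

context random_walk
begin

abbreviation path :: "'a \<Rightarrow> (nat \<Rightarrow> 'a) \<Rightarrow> nat \<Rightarrow> 'a" where
  "path g \<omega> \<equiv> path_act G g (walk G \<omega>)"

lemma path_one: "(\<And>n. \<omega> n \<in> carrier G) \<Longrightarrow> path \<one> \<omega> = walk G \<omega>"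
  by (simp add: path_act_def walk_closed fun_eq_iff)

text \<open>The Markov property for trajectories. A path from \<open>g\<close> first records
  \<open>g\<close> times the first increment, so one shift removes precisely that increment and
  moves the starting point.\<close>

lemma shift_path_case_nat:
  assumes "g \<in> carrier G" "s \<in> carrier G" "\<And>n. \<omega> n \<in> carrier G"
  shows "shift (path g (case_nat s \<omega>)) = path (g \<otimes> s) \<omega>"
  using assms by (simp add: shift_def path_act_def fun_eq_iff walk_case_nat m_assoc walk_closed
      del: walk.simps)

text \<open>For an invariant event this function of the starting point is the Poisson transform of
  its indicator.\<close>

definition hit :: "'a \<Rightarrow> (nat \<Rightarrow> 'a) set \<Rightarrow> real" where
  "hit g E = inc.P.prob {\<omega>. path g \<omega> \<in> E}"

lemma sets_path_in:
  assumes [measurable]: "E \<in> sets path_space"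
  shows "{\<omega>. path g \<omega> \<in> E} \<in> sets \<Omega>" "{\<omega>. walk G \<omega> \<in> E} \<in> sets \<Omega>"
proof -
  have "{\<omega> \<in> space \<Omega>. path g \<omega> \<in> E} \<in> sets \<Omega>" "{\<omega> \<in> space \<Omega>. walk G \<omega> \<in> E} \<in> sets \<Omega>" by measurable
  then show "{\<omega>. path g \<omega> \<in> E} \<in> sets \<Omega>" "{\<omega>. walk G \<omega> \<in> E} \<in> sets \<Omega>" by simp_all
qed

lemma measurable_indicator_path:
  assumes "E \<in> sets path_space"
  shows "(\<lambda>\<omega>. indicat_real E (path g \<omega>)) \<in> borel_measurable \<Omega>"
    and "(\<lambda>\<omega>. indicat_real E (walk G \<omega>)) \<in> borel_measurable \<Omega>"
proof -
  have ind: "indicat_real E \<in> borel_measurable path_space" using assms by simp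
  show "(\<lambda>\<omega>. indicat_real E (path g \<omega>)) \<in> borel_measurable \<Omega>"
    by (rule measurable_compose[OF measurable_path ind])
  show "(\<lambda>\<omega>. indicat_real E (walk G \<omega>)) \<in> borel_measurable \<Omega>"
    by (rule measurable_compose[OF measurable_walk_path ind])
qed

lemma hit_eq_integral:
  assumes "E \<in> sets path_space"
  shows "hit g E = (\<integral>\<omega>. indicator E (path g \<omega>) \<partial>\<Omega>)"
proof -
  have "(\<lambda>\<omega>. indicat_real E (path g \<omega>)) = indicator {\<omega>. path g \<omega> \<in> E}"
    by (auto simp: indicator_def)
  then show ?thesis using sets_path_in[OF assms] by (simp add: hit_def)
qed

lemma hit_bounds: "0 \<le> hit g E" "hit g E \<le> 1" "\<bar>hit g E\<bar> \<le> 1"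
  by (simp_all add: hit_def)

lemma hit_one:
  assumes "E \<in> sets path_space"
  shows "hit \<one> E = inc.P.prob {\<omega>. walk G \<omega> \<in> E}"
  unfolding hit_def
proof (rule measure_eq_AE)
  show "AE \<omega> in \<Omega>. (\<omega> \<in> {\<omega>. path \<one> \<omega> \<in> E}) = (\<omega> \<in> {\<omega>. walk G \<omega> \<in> E})"
    using AE_increments_carrier by eventually_elim (simp add: path_one)
qed (use sets_path_in[OF assms] in auto)

text \<open>Condition on the first increment. The event does not notice the removal of the first
  position, and what remains is a walk from \<open>g \<otimes> s\<close>.\<close>

lemma harmonic_hit:
  assumes E: "E \<in> shift_invariant_sets"
  shows "harmonic (\<lambda>g. hit g E)"
  unfolding harmonic_def
proof
  fix g assume g: "g \<in> carrier G"
  note Es = shift_invariant_sets_sets[OF E]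
  have "hit g E = (\<integral>s. \<integral>\<omega>. indicator E (path g (case_nat s \<omega>)) \<partial>\<Omega> \<partial>measure_pmf \<mu>)"
    unfolding hit_eq_integral[OF Es]
    by (rule integral_case_nat[OF measurable_indicator_path(1)[OF Es], of _ 1]) (simp add: indicator_def)
  also have "\<dots> = (\<integral>s. hit (g \<otimes> s) E \<partial>measure_pmf \<mu>)"
  proof (rule integral_cong_AE)
    show "AE s in measure_pmf \<mu>. (\<integral>\<omega>. indicator E (path g (case_nat s \<omega>)) \<partial>\<Omega>) = hit (g \<otimes> s) E"
      unfolding AE_measure_pmf_iff hit_eq_integral[OF Es]
    proof
      fix s assume s: "s \<in> set_pmf \<mu>"
      show "(\<integral>\<omega>. indicat_real E (path g (case_nat s \<omega>)) \<partial>\<Omega>) = (\<integral>\<omega>. indicator E (path (g \<otimes> s) \<omega>) \<partial>\<Omega>)"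
      proof (rule integral_cong_AE)
        show "AE \<omega> in \<Omega>. indicat_real E (path g (case_nat s \<omega>)) = indicator E (path (g \<otimes> s) \<omega>)"
          using AE_increments_carrier
        proof eventually_elim
          case (elim \<omega>)
          then show ?case
            using shift_invariant_shift_iff[OF E, of "path g (case_nat s \<omega>)"]
              shift_path_case_nat[OF g set_pmf_carrier[OF s], of \<omega>]
            by (simp add: indicator_def)
        qed
        have "(\<lambda>\<omega>. case_nat s \<omega>) \<in> measurable \<Omega> \<Omega>" by measurable
        from measurable_compose[OF this measurable_indicator_path(1)[OF Es]]
        show "(\<lambda>\<omega>. indicat_real E (path g (case_nat s \<omega>))) \<in> borel_measurable \<Omega>" .
      qed (rule measurable_indicator_path[OF Es])
    qed
  qed auto
  finally show "hit g E = (\<integral>s. hit (g \<otimes> s) E \<partial>measure_pmf \<mu>)" .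
qed

text \<open>Where the maximum is attained, the nonnegative difference from it has integral 0, so the
  maximum is attained after every step in the support. The support generates the group as a
  semigroup, so the maximum spreads everywhere.\<close>

lemma harmonic_maximum_principle:
  assumes w: "harmonic w" and D: "\<And>g. \<bar>w g\<bar> \<le> D" and max: "\<And>g. g \<in> carrier G \<Longrightarrow> w g \<le> w \<one>"
    and g: "g \<in> carrier G"
  shows "w g = w \<one>"
proof -
  have step: "w (g \<otimes> s) = w \<one>" if g: "g \<in> carrier G" "w g = w \<one>" and s: "s \<in> set_pmf \<mu>" for g s
  proof -
    have "(\<integral>t. w \<one> - w (g \<otimes> t) \<partial>measure_pmf \<mu>) = w \<one> - (\<integral>t. w (g \<otimes> t) \<partial>measure_pmf \<mu>)"
      by (subst Bochner_Integration.integral_diff) (auto intro!: pmf_integrable_bounded[OF D])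
    also have "\<dots> = 0" using w g by (simp add: harmonic_def)
    finally have "(\<integral>t. w \<one> - w (g \<otimes> t) \<partial>measure_pmf \<mu>) = 0" .
    moreover have "AE t in measure_pmf \<mu>. 0 \<le> w \<one> - w (g \<otimes> t)"
      using max g set_pmf_carrier by (auto simp: AE_measure_pmf_iff)
    moreover have "integrable (measure_pmf \<mu>) (\<lambda>t. w \<one> - w (g \<otimes> t))"
      by (intro Bochner_Integration.integrable_diff pmf_integrable_bounded[of _ D] D)
    ultimately have "AE t in measure_pmf \<mu>. w \<one> - w (g \<otimes> t) = 0"
      by (simp add: integral_nonneg_eq_0_iff_AE)
    then show ?thesis using s by (auto simp: AE_measure_pmf_iff)
  qed
  have gen: "gen_semigroup G (set_pmf \<mu>) = carrier G" using generating by (simp add: generating_def)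
  \<comment> \<open>Quantifying over the base point lets the product case move first by
    \<open>a\<close>, then by \<open>b\<close>.\<close>
  have "\<forall>g\<in>carrier G. w g = w \<one> \<longrightarrow> w (g \<otimes> a) = w \<one>" if "a \<in> gen_semigroup G (set_pmf \<mu>)" for a
    using that
  proof induction
    case (gen_base s)
    then show ?case using step by blast
  next
    case (gen_mult a b)
    then have "a \<in> carrier G" "b \<in> carrier G" using gen by auto
    then show ?case using gen_mult by (simp add: m_assoc[symmetric])
  qed
  from this[of g] g gen show ?thesis by auto
qed

text \<open>The negated function has its maximum 0 at \<open>\<one>\<close>. Thus invariant null
  events are null for every starting point, the quasi-invariance used for the boundary
  action.\<close>

lemma hit_null:
  assumes E: "E \<in> shift_invariant_sets" and "hit \<one> E = 0" and "g \<in> carrier G"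
  shows "hit g E = 0"
proof -
  have "harmonic (\<lambda>g. - hit g E)"
    using harmonic_hit[OF E] by (simp add: harmonic_def)
  from harmonic_maximum_principle[OF this, of 1 g] show ?thesis
    using assms hit_bounds by simp
qed

text \<open>Against functions of the increments up to \<open>k\<close>, an invariant event may be
  replaced by its probability from the current position: this is its conditional
  expectation.\<close>

lemma integral_adapted_shift_invariant:
  assumes Z: "adapted k Z" and E: "E \<in> shift_invariant_sets"
  shows "(\<integral>\<omega>. Z \<omega> * indicator E (walk G \<omega>) \<partial>\<Omega>) = (\<integral>\<omega>. Z \<omega> * hit (walk G \<omega> k) E \<partial>\<Omega>)"
proof -
  note Es = shift_invariant_sets_sets[OF E]
  have Zm [measurable]: "Z \<in> borel_measurable \<Omega>" using Z by (simp add: adapted_def)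
  obtain C where C: "\<And>\<omega>. \<bar>Z \<omega>\<bar> \<le> C" using Z by (auto simp: adapted_def)
  have Zcomb: "Z (comb_seq (Suc k) \<omega> \<omega>') = Z \<omega>" for \<omega> \<omega>'
    using Z unfolding adapted_def by (auto simp: comb_seq_def)
  have C0: "0 \<le> C" using C[of undefined] by linarith
  have bound: "\<bar>Z \<omega> * indicat_real E (walk G \<omega>)\<bar> \<le> C" for \<omega>
    using C[of \<omega>] C0 by (auto simp: indicator_def)
  have meas: "(\<lambda>\<omega>. Z \<omega> * indicat_real E (walk G \<omega>)) \<in> borel_measurable \<Omega>"
    by (intro borel_measurable_times Zm measurable_indicator_path Es)
  have "(\<integral>\<omega>. Z \<omega> * indicator E (walk G \<omega>) \<partial>\<Omega>) =
      (\<integral>\<omega>. \<integral>\<omega>'. Z (comb_seq (Suc k) \<omega> \<omega>') * indicator E (walk G (comb_seq (Suc k) \<omega> \<omega>')) \<partial>\<Omega> \<partial>\<Omega>)"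
    by (rule integral_comb_seq(1)[OF meas bound])
  also have "\<dots> = (\<integral>\<omega>. Z \<omega> * hit (walk G \<omega> k) E \<partial>\<Omega>)"
  proof (rule integral_cong_AE)
    show "AE \<omega> in \<Omega>. (\<integral>\<omega>'. Z (comb_seq (Suc k) \<omega> \<omega>') * indicator E (walk G (comb_seq (Suc k) \<omega> \<omega>')) \<partial>\<Omega>)
        = Z \<omega> * hit (walk G \<omega> k) E"
      using AE_increments_carrier
    proof eventually_elim
      case (elim \<omega>)
      have "(\<integral>\<omega>'. Z (comb_seq (Suc k) \<omega> \<omega>') * indicator E (walk G (comb_seq (Suc k) \<omega> \<omega>')) \<partial>\<Omega>)
          = (\<integral>\<omega>'. Z \<omega> * indicator E (path (walk G \<omega> k) \<omega>') \<partial>\<Omega>)"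
      proof (rule integral_cong_AE)
        show "AE \<omega>' in \<Omega>. Z (comb_seq (Suc k) \<omega> \<omega>') * indicator E (walk G (comb_seq (Suc k) \<omega> \<omega>'))
            = Z \<omega> * indicator E (path (walk G \<omega> k) \<omega>')"
          using AE_increments_carrier
        proof eventually_elim
          case (elim \<omega>')
          \<comment> \<open>Dropping the positions 0 to k leaves the walk driven by the second
            sequence from the position at time \<open>k\<close>; invariance of \<open>E\<close>
            permits the drop.\<close>
          have "(\<lambda>n. walk G (comb_seq (Suc k) \<omega> \<omega>') (Suc k + n)) = path (walk G \<omega> k) \<omega>'"
            unfolding path_act_def using elim \<open>\<forall>n. \<omega> n \<in> carrier G\<close> by (intro ext walk_comb_seq) auto
          then show ?case
            using shift_invariant_drop_iff[OF E, of "walk G (comb_seq (Suc k) \<omega> \<omega>')" "Suc k"]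
            by (simp only: Zcomb indicator_def)
        qed
        have "(\<lambda>\<omega>'. comb_seq (Suc k) \<omega> \<omega>') \<in> measurable \<Omega> \<Omega>" by measurable
        from measurable_compose[OF this meas]
        show "(\<lambda>\<omega>'. Z (comb_seq (Suc k) \<omega> \<omega>') * indicator E (walk G (comb_seq (Suc k) \<omega> \<omega>')))
            \<in> borel_measurable \<Omega>" .
      qed (intro borel_measurable_times borel_measurable_const measurable_indicator_path Es)
      then show ?case by (simp add: hit_eq_integral[OF Es])
    qed
  qed (use integral_comb_seq(2)[OF meas bound] in measurable)
  finally show ?thesis .
qed

text \<open>If the probability is the same from every position, the event is independent of each
  cylinder, hence of itself.\<close>

lemma hit_zero_one:
  assumes E: "E \<in> shift_invariant_sets" and const: "\<And>g. g \<in> carrier G \<Longrightarrow> hit g E = hit \<one> E"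
  shows "hit \<one> E = 0 \<or> hit \<one> E = 1"
proof -
  note Es = shift_invariant_sets_sets[OF E]
  define A where "A = {\<omega>. walk G \<omega> \<in> E}"
  have A [measurable]: "A \<in> sets \<Omega>" using sets_path_in[OF Es] by (simp add: A_def)
  define c where "c = hit \<one> E"
  have c0: "0 \<le> c" by (simp add: c_def hit_bounds)
  have cA: "inc.P.prob A = c" using hit_one[OF Es] by (simp add: A_def c_def)
  \<comment> \<open>Independence as an equality of finite measures, which need only be checked on
    cylinders.\<close>
  have "density \<Omega> (indicator A) = scale_measure (ennreal c) \<Omega>"
  proof (rule measure_eqI_PiM_infinite[where M = "\<lambda>_. measure_pmf \<mu>" and I = UNIV])
    fix T :: "nat \<Rightarrow> 'a set" and J :: "nat set"
    assume J: "finite J"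
    let ?C = "prod_emb UNIV (\<lambda>_. measure_pmf \<mu>) J (Pi\<^sub>E J T)"
    have C [measurable]: "?C \<in> sets \<Omega>" by (rule sets_PiM_I) (use J in auto)
    have mem: "\<omega> \<in> ?C \<longleftrightarrow> (\<forall>j\<in>J. \<omega> j \<in> T j)" for \<omega>
      by (auto simp: prod_emb_def PiE_iff space_PiM)
    obtain k where k: "\<And>j. j \<in> J \<Longrightarrow> j \<le> k" using J by (auto simp: finite_nat_set_iff_bounded_le)
    have Z: "adapted k (indicator ?C)"
      unfolding adapted_def
    proof (intro conjI allI impI)
      show "\<exists>c. \<forall>\<omega>. \<bar>indicat_real ?C \<omega>\<bar> \<le> c" by (intro exI[of _ 1]) (auto simp: indicator_def)
      fix \<omega> \<omega>' :: "nat \<Rightarrow> 'a" assume "\<forall>j\<le>k. \<omega> j = \<omega>' j"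
      then have "\<omega> \<in> ?C \<longleftrightarrow> \<omega>' \<in> ?C" unfolding mem using k by auto
      then show "indicat_real ?C \<omega> = indicator ?C \<omega>'" by (simp add: indicator_def)
    qed measurable
    have "inc.P.prob (A \<inter> ?C) = (\<integral>\<omega>. indicator (A \<inter> ?C) \<omega> \<partial>\<Omega>)" by simp
    also have "\<dots> = (\<integral>\<omega>. indicator ?C \<omega> * indicator E (walk G \<omega>) \<partial>\<Omega>)"
      by (intro Bochner_Integration.integral_cong) (auto simp: A_def indicator_def)
    also have "\<dots> = (\<integral>\<omega>. indicator ?C \<omega> * hit (walk G \<omega> k) E \<partial>\<Omega>)"
      by (rule integral_adapted_shift_invariant[OF Z E])
    also have "\<dots> = (\<integral>\<omega>. indicator ?C \<omega> * c \<partial>\<Omega>)"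
    proof (rule integral_cong_AE)
      show "AE \<omega> in \<Omega>. indicator ?C \<omega> * hit (walk G \<omega> k) E = indicator ?C \<omega> * c"
        using AE_increments_carrier
      proof eventually_elim
        case (elim \<omega>)
        then have "hit (walk G \<omega> k) E = c" unfolding c_def by (intro const walk_closed) auto
        then show ?case by simp
      qed
    qed measurable
    also have "\<dots> = c * inc.P.prob ?C" by simp
    finally have "inc.P.prob (A \<inter> ?C) = c * inc.P.prob ?C" .
    then show "emeasure (density \<Omega> (indicator A)) ?C = emeasure (scale_measure (ennreal c) \<Omega>) ?C"
      by (simp add: emeasure_restricted inc.P.emeasure_eq_measure ennreal_mult c0)
  next
    show "finite_measure (density \<Omega> (indicator A))"
      by (rule finite_measureI) (simp add: emeasure_restricted inc.P.emeasure_eq_measure del: space_\<Omega>)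
  qed auto
  \<comment> \<open>Evaluation at \<open>A\<close> itself yields c = c * c.\<close>
  then have "emeasure (density \<Omega> (indicator A)) A = emeasure (scale_measure (ennreal c) \<Omega>) A" by simp
  then have "inc.P.prob A = c * inc.P.prob A"
    by (simp add: emeasure_restricted inc.P.emeasure_eq_measure ennreal_mult[symmetric] c0)
  then show ?thesis unfolding cA by (auto simp: c_def[symmetric])
qed

text \<open>\<open>u F g\<close> is a Banach limit of the expectations of F at g times the walk.
  Shift invariance of the Banach limit makes it harmonic; the other clauses are what turns its
  boundary values into a mean that is equivariant under translations.\<close>

lemma exists_harmonic_averages:
  obtains u :: "('a \<Rightarrow> real) \<Rightarrow> 'a \<Rightarrow> real" where
    "\<And>F C. (\<And>x. x \<in> carrier G \<Longrightarrow> \<bar>F x\<bar> \<le> C) \<Longrightarrow> 0 \<le> C \<Longrightarrow> harmonic (u F) \<and> (\<forall>g. \<bar>u F g\<bar> \<le> C)"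
    "\<And>F F'. (\<And>x. x \<in> carrier G \<Longrightarrow> F x = F' x) \<Longrightarrow> u F = u F'"
    "\<And>F F' a b. bounded (F ` carrier G) \<Longrightarrow> bounded (F' ` carrier G) \<Longrightarrow>
      u (\<lambda>x. a * F x + b * F' x) = (\<lambda>g. a * u F g + b * u F' g)"
    "\<And>F g. bounded (F ` carrier G) \<Longrightarrow> (\<And>x. x \<in> carrier G \<Longrightarrow> 0 \<le> F x) \<Longrightarrow> 0 \<le> u F g"
    "\<And>g. g \<in> carrier G \<Longrightarrow> u (\<lambda>_. 1) g = 1"
    "\<And>F g h. g \<in> carrier G \<Longrightarrow> h \<in> carrier G \<Longrightarrow>
      u (\<lambda>x. F (h \<otimes> x)) g = u F (h \<otimes> g)"
proof -
  obtain L :: "(nat \<Rightarrow> real) \<Rightarrow> real" where L: "mean_on UNIV L"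
    and Lshift: "\<And>f. bounded (range f) \<Longrightarrow> L (\<lambda>n. f (Suc n)) = L f"
    using banach_limit_exists by blast
  \<comment> \<open>Extension by 0 off the carrier: the increments may leave the group on a null
    set, and \<open>F\<close> is bounded only on the carrier.\<close>
  define e where "e F x = (if x \<in> carrier G then F x else 0)" for F :: "'a \<Rightarrow> real" and x
  define a where "a F g n = (\<integral>\<omega>. e F (g \<otimes> walk G \<omega> n) \<partial>\<Omega>)" for F g n
  define u where "u F g = L (a F g)" for F g
  have em: "(\<lambda>\<omega>. e F (g \<otimes> walk G \<omega> n)) \<in> borel_measurable \<Omega>" for F g n
    by (rule borel_measurable_walk)
  have eint: "integrable \<Omega> (\<lambda>\<omega>. e F (g \<otimes> walk G \<omega> n))" if F: "bounded (F ` carrier G)" for F g n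
  proof -
    obtain C where C: "\<And>x. x \<in> carrier G \<Longrightarrow> \<bar>F x\<bar> \<le> C" using F by (auto simp: bounded_iff)
    have "0 \<le> C" using C[OF one_closed] by linarith
    then show ?thesis by (intro integrable_\<Omega>_bounded[of _ C] em) (simp add: e_def C)
  qed
  have aC: "\<bar>a F g n\<bar> \<le> C" if "\<And>x. x \<in> carrier G \<Longrightarrow> \<bar>F x\<bar> \<le> C" "0 \<le> C" for F g n C
  proof -
    have "bounded (F ` carrier G)" using that(1) by (auto simp: bounded_iff)
    then have "\<bar>a F g n\<bar> \<le> (\<integral>\<omega>. \<bar>e F (g \<otimes> walk G \<omega> n)\<bar> \<partial>\<Omega>)"
      unfolding a_def by (intro integral_abs_bound)
    also have "\<dots> \<le> C"
      using that eint[OF \<open>bounded (F ` carrier G)\<close>]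
      by (intro inc.P.integral_le_const) (auto simp: e_def)
    finally show ?thesis .
  qed
  have abound: "bounded (range (a F g))" if F: "bounded (F ` carrier G)" for F g
  proof -
    obtain C where C: "\<And>x. x \<in> carrier G \<Longrightarrow> \<bar>F x\<bar> \<le> C" using F by (auto simp: bounded_iff)
    have "0 \<le> C" using C[OF one_closed] by linarith
    then have "\<bar>a F g n\<bar> \<le> C" for n using C by (intro aC) auto
    then show ?thesis by (auto simp: bounded_iff)
  qed
  show thesis
  proof (rule that[of u])
    fix F :: "'a \<Rightarrow> real" and C :: real
    assume C: "\<And>x. x \<in> carrier G \<Longrightarrow> \<bar>F x\<bar> \<le> C" and C0: "0 \<le> C"
    have uC: "\<bar>u F g\<bar> \<le> C" for g
      unfolding u_def using aC[OF C C0] by (intro mean_on_abs_le[OF L])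
    have eC: "\<bar>e F x\<bar> \<le> C" for x using C C0 by (simp add: e_def)
    have "u F g = (\<integral>s. u F (g \<otimes> s) \<partial>measure_pmf \<mu>)" if g: "g \<in> carrier G" for g
    proof -
      have step: "a F g (Suc n) = (\<integral>s. a F (g \<otimes> s) n \<partial>measure_pmf \<mu>)" for n
      proof -
        have "a F g (Suc n) = (\<integral>s. \<integral>\<omega>. e F (g \<otimes> walk G (case_nat s \<omega>) (Suc n)) \<partial>\<Omega> \<partial>measure_pmf \<mu>)"
          unfolding a_def by (rule integral_case_nat[OF em eC])
        also have "\<dots> = (\<integral>s. a F (g \<otimes> s) n \<partial>measure_pmf \<mu>)"
        proof (rule integral_cong_AE)
          show "AE s in measure_pmf \<mu>.
              (\<integral>\<omega>. e F (g \<otimes> walk G (case_nat s \<omega>) (Suc n)) \<partial>\<Omega>) = a F (g \<otimes> s) n"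
            unfolding AE_measure_pmf_iff a_def
          proof
            fix s assume "s \<in> set_pmf \<mu>"
            then have s: "s \<in> carrier G" by (rule set_pmf_carrier)
            show "(\<integral>\<omega>. e F (g \<otimes> walk G (case_nat s \<omega>) (Suc n)) \<partial>\<Omega>)
                = (\<integral>\<omega>. e F (g \<otimes> s \<otimes> walk G \<omega> n) \<partial>\<Omega>)"
            proof (rule integral_cong_AE)
              have "(\<lambda>\<omega>. case_nat s \<omega>) \<in> measurable \<Omega> \<Omega>" by measurable
              from measurable_compose[OF this em]
              show "(\<lambda>\<omega>. e F (g \<otimes> walk G (case_nat s \<omega>) (Suc n))) \<in> borel_measurable \<Omega>" .
              show "AE \<omega> in \<Omega>. e F (g \<otimes> walk G (case_nat s \<omega>) (Suc n)) = e F (g \<otimes> s \<otimes> walk G \<omega> n)"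
                using AE_increments_carrier
              proof eventually_elim
                case (elim \<omega>)
                then have "g \<otimes> walk G (case_nat s \<omega>) (Suc n) = g \<otimes> s \<otimes> walk G \<omega> n"
                  using walk_case_nat[OF s, of \<omega> n] walk_closed[of \<omega> n] g s
                  by (simp add: m_assoc del: walk.simps)
                then show ?case by (simp only:)
              qed
            qed (rule em)
          qed
        qed auto
        finally show ?thesis .
      qed
      \<comment> \<open>Shift the Banach limit by one time unit, expand the first step, and move the
        Banach limit inside the integral over that step.\<close>
      have "u F g = L (\<lambda>n. a F g (Suc n))"
        unfolding u_def by (rule Lshift[symmetric], rule abound) (use C in \<open>auto simp: bounded_iff\<close>)
      also have "\<dots> = (\<integral>s. L (\<lambda>n. a F (g \<otimes> s) n) \<partial>measure_pmf \<mu>)"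
        unfolding step by (rule mean_on_pmf_integral_commute[OF L, of _ C]) (rule aC[OF C C0])
      finally show ?thesis by (simp add: u_def)
    qed
    then show "harmonic (u F) \<and> (\<forall>g. \<bar>u F g\<bar> \<le> C)" using uC by (simp add: harmonic_def)
  next
    fix F F' :: "'a \<Rightarrow> real" assume "\<And>x. x \<in> carrier G \<Longrightarrow> F x = F' x"
    then have "e F = e F'" by (auto simp: e_def)
    then have "a F = a F'" by (simp add: a_def fun_eq_iff)
    then show "u F = u F'" by (intro ext) (simp only: u_def)
  next
    fix F F' :: "'a \<Rightarrow> real" and c d :: real
    assume F: "bounded (F ` carrier G)" and F': "bounded (F' ` carrier G)"
    have "a (\<lambda>x. c * F x + d * F' x) g n = c * a F g n + d * a F' g n" for g n
    proof -
      have "a (\<lambda>x. c * F x + d * F' x) g n =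
          (\<integral>\<omega>. c * e F (g \<otimes> walk G \<omega> n) + d * e F' (g \<otimes> walk G \<omega> n) \<partial>\<Omega>)"
        unfolding a_def by (intro Bochner_Integration.integral_cong) (auto simp: e_def)
      then show ?thesis using eint[OF F] eint[OF F'] by (simp add: a_def)
    qed
    then have "a (\<lambda>x. c * F x + d * F' x) g = (\<lambda>n. c * a F g n + d * a F' g n)" for g by auto
    then show "u (\<lambda>x. c * F x + d * F' x) = (\<lambda>g. c * u F g + d * u F' g)"
      unfolding u_def by (intro ext) (simp add: mean_on_linear[OF L abound[OF F] abound[OF F']])
  next
    fix F :: "'a \<Rightarrow> real" and g
    assume F: "bounded (F ` carrier G)" and nn: "\<And>x. x \<in> carrier G \<Longrightarrow> 0 \<le> F x"
    have "0 \<le> a F g n" for n unfolding a_def using nn by (intro Bochner_Integration.integral_nonneg) (simp add: e_def)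
    then show "0 \<le> u F g" unfolding u_def by (intro mean_on_nonneg[OF L] abound F)
  next
    fix g assume g: "g \<in> carrier G"
    have "a (\<lambda>_. 1) g n = 1" for n
    proof -
      have "a (\<lambda>_. 1) g n = (\<integral>\<omega>. 1 \<partial>\<Omega>)"
        unfolding a_def
      proof (rule integral_cong_AE[OF em])
        show "AE \<omega> in \<Omega>. e (\<lambda>_. 1) (g \<otimes> walk G \<omega> n) = 1"
          using AE_increments_carrier by eventually_elim (simp add: e_def g walk_closed)
      qed simp
      then show ?thesis by (simp add: inc.P.prob_space[unfolded space_\<Omega>])
    qed
    then have "a (\<lambda>_. 1) g = (\<lambda>_. 1)" by auto
    then show "u (\<lambda>_. 1) g = 1" by (simp add: u_def mean_on_one[OF L])
  next
    fix F :: "'a \<Rightarrow> real" and g h assume g: "g \<in> carrier G" and h: "h \<in> carrier G"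
    have "a (\<lambda>x. F (h \<otimes> x)) g n = a F (h \<otimes> g) n" for n
      unfolding a_def
    proof (rule integral_cong_AE[OF em em])
      show "AE \<omega> in \<Omega>. e (\<lambda>x. F (h \<otimes> x)) (g \<otimes> walk G \<omega> n) = e F (h \<otimes> g \<otimes> walk G \<omega> n)"
        using AE_increments_carrier by eventually_elim (simp add: e_def g h walk_closed m_assoc)
    qed
    then have "a (\<lambda>x. F (h \<otimes> x)) g = a F (h \<otimes> g)" by auto
    then show "u (\<lambda>x. F (h \<otimes> x)) g = u F (h \<otimes> g)" by (simp add: u_def)
  qed
qed

end

section \<open>Stabilizers of boundary points\<close>

locale poisson_boundary_realization = random_walk G \<mu>
  for G :: "('a::countable, 'b) monoid_scheme" (structure) and \<mu> :: "'a pmf" +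
  fixes B :: "'c::polish_space measure" and act :: "'a \<Rightarrow> 'c \<Rightarrow> 'c" and \<pi> :: "(nat \<Rightarrow> 'a) \<Rightarrow> 'c"
  assumes boundary: "poisson_boundary G \<mu> B act \<pi>"
begin

lemma act_measurable: "g \<in> carrier G \<Longrightarrow> act g \<in> measurable B B"
  and act_one: "x \<in> space B \<Longrightarrow> act \<one> x = x"
  and act_mult: "g \<in> carrier G \<Longrightarrow> h \<in> carrier G \<Longrightarrow> x \<in> space B \<Longrightarrow>
    act (g \<otimes> h) x = act g (act h x)"
  and \<pi>_measurable: "\<pi> \<in> measurable path_space B"
  and \<pi>_vimage_invariant: "E \<in> sets B \<Longrightarrow> \<pi> -` E \<in> shift_invariant_sets"
  using boundary by (simp_all add: poisson_boundary_def)

lemma act_space: "g \<in> carrier G \<Longrightarrow> x \<in> space B \<Longrightarrow> act g x \<in> space B"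
  by (rule measurable_space[OF act_measurable])

lemma \<pi>_space: "\<pi> x \<in> space B"
  using measurable_space[OF \<pi>_measurable, of x] by simp

lemma B_eq_distr: "B = distr \<Omega> B (\<lambda>\<omega>. \<pi> (walk G \<omega>))"
proof -
  have "B = distr (path_measure G \<mu>) B \<pi>" using boundary by (simp add: poisson_boundary_def)
  also have "\<dots> = distr \<Omega> B (\<lambda>\<omega>. \<pi> (walk G \<omega>))"
    unfolding path_measure_def by (subst distr_distr) (auto simp: \<pi>_measurable comp_def)
  finally show ?thesis .
qed

lemma AE_boundary_iff:
  assumes "{x \<in> space B. P x} \<in> sets B"
  shows "(AE x in B. P x) \<longleftrightarrow> (AE \<omega> in \<Omega>. P (\<pi> (walk G \<omega>)))"
  using AE_distr_iff[OF measurable_compose[OF measurable_walk_path \<pi>_measurable] assms]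
  unfolding B_eq_distr[symmetric] .

lemma AE_\<pi>_equivariant:
  assumes "g \<in> carrier G"
  shows "AE \<omega> in \<Omega>. \<pi> (path g \<omega>) = act g (\<pi> (walk G \<omega>))"
proof -
  have "AE x in path_measure G \<mu>. \<pi> (path_act G g x) = act g (\<pi> x)"
    using boundary assms by (simp add: poisson_boundary_def)
  then have "AE x in distr \<Omega> path_space (walk G). \<pi> (path_act G g x) = act g (\<pi> x)"
    by (simp only: path_measure_def)
  from AE_distrD[OF measurable_walk_path this] show ?thesis .
qed

text \<open>\<open>B\<close> carries the Borel structure of a subset of a Polish space, so the set
  where two measurable maps agree is measurable.\<close>

lemma fixed_points_sets:
  assumes "g \<in> carrier G"
  shows "{x \<in> space B. act g x = x} \<in> sets B"
proof -
  have eq: "sets B = sets (restrict_space borel (space B))"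
    using boundary by (simp add: poisson_boundary_def)
  have "f \<in> borel_measurable B" if "f \<in> measurable B B" for f
    using that unfolding measurable_cong_sets[OF refl eq] measurable_restrict_space2_iff by simp
  from this[OF act_measurable[OF assms]] this[of "\<lambda>x. x"] show ?thesis
    by (intro measurable_equality_set) auto
qed

lemma common_fixed_points_sets:
  assumes "S \<subseteq> carrier G"
  shows "{x \<in> space B. \<forall>g\<in>S. act g x = x} \<in> sets B"
  unfolding Ball_def
proof (rule sets.sets_Collect_countable_All)
  fix g show "{x \<in> space B. g \<in> S \<longrightarrow> act g x = x} \<in> sets B"
    using assms fixed_points_sets[of g] by (cases "g \<in> S") auto
qed

lemma stabilizer_sets: "{x \<in> space B. stabilizer G act x = K} \<in> sets B"
proof (cases "K \<subseteq> carrier G")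
  case True
  have "{x \<in> space B. stabilizer G act x = K} =
      {x \<in> space B. \<forall>g. g \<in> carrier G \<longrightarrow> (act g x = x) = (g \<in> K)}"
    using True by (auto simp: stabilizer_def)
  also have "\<dots> \<in> sets B"
  proof (rule sets.sets_Collect_countable_All)
    fix g
    show "{x \<in> space B. g \<in> carrier G \<longrightarrow> (act g x = x) = (g \<in> K)} \<in> sets B"
    proof (cases "g \<in> carrier G")
      case True
      then show ?thesis
        using fixed_points_sets[of g] sets.sets_Collect_neg[of B "\<lambda>x. act g x = x"]
        by (cases "g \<in> K") auto
    qed simp
  qed
  finally show ?thesis .
next
  case False
  then have "{x \<in> space B. stabilizer G act x = K} = {}" by (auto simp: stabilizer_def)
  then show ?thesis by (simp only: sets.empty_sets)
qed

lemma stabilizer_subgroup: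
  assumes x: "x \<in> space B"
  shows "subgroup (stabilizer G act x) G"
proof (rule subgroupI)
  show "stabilizer G act x \<noteq> {}" using act_one[OF x] by (auto simp: stabilizer_def)
  fix g assume g: "g \<in> stabilizer G act x"
  then have "act (inv g) (act g x) = x"
    using act_mult[of "inv g" g x] act_one[OF x] x by (simp add: stabilizer_def)
  then show "inv g \<in> stabilizer G act x" using g by (simp add: stabilizer_def)
  fix h assume "h \<in> stabilizer G act x"
  then show "g \<otimes> h \<in> stabilizer G act x" using g x by (simp add: stabilizer_def act_mult)
qed (auto simp: stabilizer_def)

text \<open>The conjugation rule Stab(gx) = g Stab(x) g^-1, solved for Stab(x) so that a prescribed
  value at the moved point becomes a prescribed value at \<open>x\<close>.\<close>

lemma stabilizer_act_iff:
  assumes g: "g \<in> carrier G" and x: "x \<in> space B" and K: "K \<subseteq> carrier G"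
  shows "stabilizer G act (act g x) = K \<longleftrightarrow> stabilizer G act x = (\<lambda>k. inv g \<otimes> k \<otimes> g) ` K"
proof -
  have *: "k \<in> stabilizer G act (act g x) \<longleftrightarrow> inv g \<otimes> k \<otimes> g \<in> stabilizer G act x"
    if k: "k \<in> carrier G" for k
  proof
    assume "k \<in> stabilizer G act (act g x)"
    then have "act k (act g x) = act g x" by (simp add: stabilizer_def)
    then have "act (inv g \<otimes> k \<otimes> g) x = act (inv g \<otimes> g) x"
      using g k x by (simp only: act_mult act_space inv_closed m_closed)
    then show "inv g \<otimes> k \<otimes> g \<in> stabilizer G act x"
      using g k x by (simp add: stabilizer_def act_one)
  next
    assume "inv g \<otimes> k \<otimes> g \<in> stabilizer G act x"
    then have "act g (act (inv g \<otimes> k \<otimes> g) x) = act g x" by (simp add: stabilizer_def)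
    moreover have "g \<otimes> (inv g \<otimes> k \<otimes> g) = k \<otimes> g"
      using g k by (simp add: m_assoc[symmetric])
    ultimately have "act (k \<otimes> g) x = act g x"
      using g k x act_mult[of g "inv g \<otimes> k \<otimes> g" x] by simp
    then show "k \<in> stabilizer G act (act g x)"
      using g k x by (simp add: stabilizer_def act_mult)
  qed
  have conj: "inv g \<otimes> (g \<otimes> h \<otimes> inv g) \<otimes> g = h" "g \<otimes> (inv g \<otimes> h \<otimes> g) \<otimes> inv g = h"
    if "h \<in> carrier G" for h
  proof -
    have "inv g \<otimes> (g \<otimes> h \<otimes> inv g) \<otimes> g = (inv g \<otimes> g) \<otimes> h \<otimes> (inv g \<otimes> g)"
      using g that by (simp only: m_assoc inv_closed m_closed)
    then show "inv g \<otimes> (g \<otimes> h \<otimes> inv g) \<otimes> g = h" using g that by simp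
    have "g \<otimes> (inv g \<otimes> h \<otimes> g) \<otimes> inv g = (g \<otimes> inv g) \<otimes> h \<otimes> (g \<otimes> inv g)"
      using g that by (simp only: m_assoc inv_closed m_closed)
    then show "g \<otimes> (inv g \<otimes> h \<otimes> g) \<otimes> inv g = h" using g that by simp
  qed
  have sub: "stabilizer G act y \<subseteq> carrier G" for y by (auto simp: stabilizer_def)
  show ?thesis
  proof
    assume K': "stabilizer G act (act g x) = K"
    show "stabilizer G act x = (\<lambda>k. inv g \<otimes> k \<otimes> g) ` K"
    proof (intro Set.set_eqI iffI)
      fix h assume h: "h \<in> stabilizer G act x"
      then have hc: "h \<in> carrier G" using sub by auto
      then have "g \<otimes> h \<otimes> inv g \<in> K" using *[of "g \<otimes> h \<otimes> inv g"] K' h conj g by simp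
      then show "h \<in> (\<lambda>k. inv g \<otimes> k \<otimes> g) ` K" using conj(1)[OF hc] by (metis imageI)
    next
      fix h assume "h \<in> (\<lambda>k. inv g \<otimes> k \<otimes> g) ` K"
      then show "h \<in> stabilizer G act x" using * K' K by auto
    qed
  next
    assume K': "stabilizer G act x = (\<lambda>k. inv g \<otimes> k \<otimes> g) ` K"
    show "stabilizer G act (act g x) = K"
    proof (intro Set.set_eqI iffI)
      fix k assume k: "k \<in> stabilizer G act (act g x)"
      then have kc: "k \<in> carrier G" using sub by auto
      then obtain l where l: "l \<in> K" "inv g \<otimes> k \<otimes> g = inv g \<otimes> l \<otimes> g" using * k K' by auto
      then have "k = l" using conj(2)[OF kc] conj(2)[of l] K by auto
      then show "k \<in> K" using l by simp
    next
      fix k assume "k \<in> K"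
      then show "k \<in> stabilizer G act (act g x)" using * K' K by auto
    qed
  qed
qed

text \<open>Modulo a null set, membership in \<open>E\<close> is read off from the boundary point.
  If \<open>h\<close> fixes that point, equivariance gives the walk and its translate by
  \<open>h\<close> the same boundary point.\<close>

lemma AE_fixed_shift_invariant_set:
  assumes E: "E \<in> shift_invariant_sets" and h: "h \<in> carrier G"
  shows "AE \<omega> in \<Omega>. act h (\<pi> (walk G \<omega>)) = \<pi> (walk G \<omega>) \<longrightarrow> (path h \<omega> \<in> E \<longleftrightarrow> walk G \<omega> \<in> E)"
proof -
  obtain E' where E': "E' \<in> sets B"
    and null: "emeasure (path_measure G \<mu>) ((E - \<pi> -` E') \<union> (\<pi> -` E' - E)) = 0"
    using boundary E by (auto simp: poisson_boundary_def)
  \<comment> \<open>The exceptional set is itself invariant, so \<open>hit_null\<close> makes it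
    null for the walk from \<open>h\<close> too.\<close>
  define D where "D = (E - \<pi> -` E') \<union> (\<pi> -` E' - E)"
  have inv': "\<pi> -` E' \<in> shift_invariant_sets" by (rule \<pi>_vimage_invariant[OF E'])
  have D: "D \<in> shift_invariant_sets"
  proof (rule shift_invariant_setsI)
    show "D \<in> sets path_space"
      unfolding D_def using shift_invariant_sets_sets[OF E] shift_invariant_sets_sets[OF inv'] by auto
    show "shift x \<in> D \<longleftrightarrow> x \<in> D" for x
      unfolding D_def using shift_invariant_shift_iff[OF E, of x] shift_invariant_shift_iff[OF inv', of x]
      by auto
  qed
  note Ds = shift_invariant_sets_sets[OF D]
  have "emeasure (path_measure G \<mu>) D = emeasure \<Omega> {\<omega>. walk G \<omega> \<in> D}"
    unfolding path_measure_def using Ds by (subst emeasure_distr) (auto simp: vimage_def)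
  then have "hit \<one> D = 0"
    using null unfolding hit_one[OF Ds] D_def[symmetric] by (simp add: inc.P.emeasure_eq_measure)
  then have hD: "hit h D = 0" "hit \<one> D = 0" using hit_null[OF D _ h] by auto
  have "AE \<omega> in \<Omega>. path h \<omega> \<notin> D"
    using hD(1) sets_path_in[OF Ds]
    by (intro AE_I[of _ _ "{\<omega>. path h \<omega> \<in> D}"]) (auto simp: hit_def inc.P.emeasure_eq_measure)
  moreover have "AE \<omega> in \<Omega>. walk G \<omega> \<notin> D"
    using hD(2) sets_path_in[OF Ds]
    by (intro AE_I[of _ _ "{\<omega>. walk G \<omega> \<in> D}"]) (auto simp: hit_one[OF Ds] inc.P.emeasure_eq_measure)
  ultimately show ?thesis
    using AE_\<pi>_equivariant[OF h] by eventually_elim (auto simp: D_def)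
qed

text \<open>Apply the version for sets to the sublevel sets at rational levels; there are countably
  many, and they separate real values.\<close>

lemma AE_fixed_shift_invariant_function:
  fixes f :: "(nat \<Rightarrow> 'a) \<Rightarrow> real"
  assumes f: "f \<in> borel_measurable path_space" "\<And>x. f (shift x) = f x" and h: "h \<in> carrier G"
  shows "AE \<omega> in \<Omega>. act h (\<pi> (walk G \<omega>)) = \<pi> (walk G \<omega>) \<longrightarrow> f (path h \<omega>) = f (walk G \<omega>)"
proof -
  have "{x \<in> space path_space. f x < of_rat q} \<in> sets path_space" for q using f(1) by measurable
  then have "{x. f x < of_rat q} \<in> shift_invariant_sets" for q
    using f(2) by (intro shift_invariant_setsI) simp_all
  from AE_fixed_shift_invariant_set[OF this h]
  have "AE \<omega> in \<Omega>. \<forall>q. act h (\<pi> (walk G \<omega>)) = \<pi> (walk G \<omega>) \<longrightarrow>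
      (f (path h \<omega>) < of_rat q \<longleftrightarrow> f (walk G \<omega>) < of_rat q)"
    unfolding AE_all_countable by simp
  then show ?thesis
  proof eventually_elim
    case (elim \<omega>)
    show ?case
    proof (intro impI antisym leI notI)
      assume fixed: "act h (\<pi> (walk G \<omega>)) = \<pi> (walk G \<omega>)"
      then have iff: "f (path h \<omega>) < of_rat q \<longleftrightarrow> f (walk G \<omega>) < of_rat q" for q
        using elim by blast
      { assume "f (walk G \<omega>) < f (path h \<omega>)"
        from of_rat_dense[OF this] show False using iff by (meson less_asym) }
      { assume "f (path h \<omega>) < f (walk G \<omega>)"
        from of_rat_dense[OF this] show False using iff by (meson less_asym) }
    qed
  qed
qed

text \<open>Average the boundary values of \<open>u F\<close> over the event that \<open>S\<close>
  fixes the boundary point. Translating \<open>F\<close> by an element of \<open>S\<close>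
  translates the trajectory, which leaves the boundary value unchanged on that event.\<close>

lemma exists_mean_of_fixed_points:
  assumes S: "S \<subseteq> carrier G"
    and pos: "inc.P.prob {\<omega>. \<forall>h\<in>S. act h (\<pi> (walk G \<omega>)) = \<pi> (walk G \<omega>)} > 0"
  shows "\<exists>m. mean_on (carrier G) m \<and>
    (\<forall>h\<in>S. \<forall>f. bounded (f ` carrier G) \<longrightarrow> m (\<lambda>x. f (h \<otimes> x)) = m f)"
proof -
  obtain u where u: "\<And>F C. (\<And>x. x \<in> carrier G \<Longrightarrow> \<bar>F x\<bar> \<le> C) \<Longrightarrow> 0 \<le> C \<Longrightarrow>
      harmonic (u F) \<and> (\<forall>g. \<bar>u F g\<bar> \<le> C)"
    and u_cong: "\<And>F F'. (\<And>x. x \<in> carrier G \<Longrightarrow> F x = F' x) \<Longrightarrow> u F = u F'"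
    and u_linear: "\<And>F F' a b. bounded (F ` carrier G) \<Longrightarrow> bounded (F' ` carrier G) \<Longrightarrow>
      u (\<lambda>x. a * F x + b * F' x) = (\<lambda>g. a * u F g + b * u F' g)"
    and u_nonneg: "\<And>F g. bounded (F ` carrier G) \<Longrightarrow> (\<And>x. x \<in> carrier G \<Longrightarrow> 0 \<le> F x) \<Longrightarrow> 0 \<le> u F g"
    and u_one: "\<And>g. g \<in> carrier G \<Longrightarrow> u (\<lambda>_. 1) g = 1"
    and u_translate: "\<And>F g h. g \<in> carrier G \<Longrightarrow> h \<in> carrier G \<Longrightarrow> u (\<lambda>x. F (h \<otimes> x)) g = u F (h \<otimes> g)"
    using exists_harmonic_averages by blast
  define A where "A = {\<omega>. \<forall>h\<in>S. act h (\<pi> (walk G \<omega>)) = \<pi> (walk G \<omega>)}"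
  have "(\<lambda>\<omega>. \<pi> (walk G \<omega>)) -` {x \<in> space B. \<forall>g\<in>S. act g x = x} \<inter> space \<Omega> \<in> sets \<Omega>"
    by (rule measurable_sets[OF measurable_compose[OF measurable_walk_path \<pi>_measurable]
          common_fixed_points_sets[OF S]])
  also have "(\<lambda>\<omega>. \<pi> (walk G \<omega>)) -` {x \<in> space B. \<forall>g\<in>S. act g x = x} \<inter> space \<Omega> = A"
    by (auto simp: A_def \<pi>_space)
  finally have A [measurable]: "A \<in> sets \<Omega>" .
  \<comment> \<open>Since \<open>lim\<close> is total, \<open>f F\<close> is measurable and
    shift-invariant at every sequence, whether or not the limit exists there.\<close>
  define f where "f F x = lim (\<lambda>n. u F (x n))" for F and x :: "nat \<Rightarrow> 'a"
  have fm: "f F \<in> borel_measurable path_space" for F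
  proof -
    have "(\<lambda>x. u F (x n)) \<in> borel_measurable path_space" for n
      unfolding path_space_def by (rule measurable_compose[OF measurable_component_singleton]) auto
    then show ?thesis unfolding f_def by (rule borel_measurable_lim_metric)
  qed
  have fshift: "f F (shift x) = f F x" for F x
    unfolding f_def lim_def shift_def using filterlim_sequentially_Suc[of "\<lambda>n. u F (x n)"] by simp
  have fwm [measurable]: "(\<lambda>\<omega>. f F (walk G \<omega>)) \<in> borel_measurable \<Omega>" for F
    by (rule measurable_compose[OF measurable_walk_path fm])
  have conv: "AE \<omega> in \<Omega>. (\<lambda>n. u F (walk G \<omega> n)) \<longlonglongrightarrow> f F (walk G \<omega>)"
    and int: "integrable \<Omega> (\<lambda>\<omega>. indicator A \<omega> * f F (walk G \<omega>))"
    if F: "bounded (F ` carrier G)" for F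
  proof -
    obtain C where C: "\<And>x. x \<in> carrier G \<Longrightarrow> \<bar>F x\<bar> \<le> C" using F by (auto simp: bounded_iff)
    have C0: "0 \<le> C" using C[OF one_closed] by linarith
    have uF: "harmonic (u F)" "\<And>g. \<bar>u F g\<bar> \<le> C" using u[OF C C0] by auto
    from harmonic_AE_convergent[OF uF]
    show conv: "AE \<omega> in \<Omega>. (\<lambda>n. u F (walk G \<omega> n)) \<longlonglongrightarrow> f F (walk G \<omega>)"
      unfolding f_def by eventually_elim (rule convergent_LIMSEQ_iff[THEN iffD1])
    have "AE \<omega> in \<Omega>. \<bar>f F (walk G \<omega>)\<bar> \<le> C"
      using conv
    proof eventually_elim
      case (elim \<omega>)
      from tendsto_rabs[OF elim] show ?case by (rule LIMSEQ_le_const2) (use uF(2) in auto)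
    qed
    then show "integrable \<Omega> (\<lambda>\<omega>. indicator A \<omega> * f F (walk G \<omega>))"
      using C0 by (intro inc.P.integrable_const_bound[of _ C]) (auto elim!: eventually_mono simp: indicator_def)
  qed
  \<comment> \<open>Conditional expectation of the boundary value given \<open>A\<close>; positivity
    of the probability normalises it.\<close>
  define m where "m F = (\<integral>\<omega>. indicator A \<omega> * f F (walk G \<omega>) \<partial>\<Omega>) / inc.P.prob A" for F
  have "mean_on (carrier G) m"
  proof (rule mean_onI)
    fix F F' :: "'a \<Rightarrow> real" assume "\<And>x. x \<in> carrier G \<Longrightarrow> F x = F' x"
    from u_cong[OF this] show "m F = m F'" by (simp add: m_def f_def)
  next
    fix F F' :: "'a \<Rightarrow> real" and a b :: real
    assume F: "bounded (F ` carrier G)" and F': "bounded (F' ` carrier G)"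
    have "(\<integral>\<omega>. indicator A \<omega> * f (\<lambda>x. a * F x + b * F' x) (walk G \<omega>) \<partial>\<Omega>) =
        (\<integral>\<omega>. a * (indicator A \<omega> * f F (walk G \<omega>)) + b * (indicator A \<omega> * f F' (walk G \<omega>)) \<partial>\<Omega>)"
    proof (rule integral_cong_AE)
      show "AE \<omega> in \<Omega>. indicator A \<omega> * f (\<lambda>x. a * F x + b * F' x) (walk G \<omega>) =
          a * (indicator A \<omega> * f F (walk G \<omega>)) + b * (indicator A \<omega> * f F' (walk G \<omega>))"
        using conv[OF F] conv[OF F']
      proof eventually_elim
        case (elim \<omega>)
        have "(\<lambda>n. a * u F (walk G \<omega> n) + b * u F' (walk G \<omega> n))
            \<longlonglongrightarrow> a * f F (walk G \<omega>) + b * f F' (walk G \<omega>)"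
          by (intro tendsto_intros elim)
        then have "f (\<lambda>x. a * F x + b * F' x) (walk G \<omega>) = a * f F (walk G \<omega>) + b * f F' (walk G \<omega>)"
          unfolding f_def u_linear[OF F F'] by (rule limI)
        then show ?case by (simp add: algebra_simps)
      qed
    qed measurable
    then show "m (\<lambda>x. a * F x + b * F' x) = a * m F + b * m F'"
      using int[OF F] int[OF F'] by (simp add: m_def add_divide_distrib)
  next
    fix F :: "'a \<Rightarrow> real"
    assume F: "bounded (F ` carrier G)" and nn: "\<And>x. x \<in> carrier G \<Longrightarrow> 0 \<le> F x"
    have "AE \<omega> in \<Omega>. 0 \<le> indicator A \<omega> * f F (walk G \<omega>)"
      using conv[OF F]
    proof eventually_elim
      case (elim \<omega>)
      from elim have "0 \<le> f F (walk G \<omega>)" by (rule LIMSEQ_le_const) (use u_nonneg[OF F nn] in auto)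
      then show ?case by simp
    qed
    then show "0 \<le> m F" unfolding m_def by (intro divide_nonneg_nonneg integral_nonneg_AE) auto
  next
    have "(\<integral>\<omega>. indicator A \<omega> * f (\<lambda>_. 1) (walk G \<omega>) \<partial>\<Omega>) = (\<integral>\<omega>. indicator A \<omega> \<partial>\<Omega>)"
    proof (rule integral_cong_AE)
      show "AE \<omega> in \<Omega>. indicator A \<omega> * f (\<lambda>_. 1) (walk G \<omega>) = indicator A \<omega>"
        using AE_increments_carrier
        by eventually_elim (simp add: f_def u_one walk_closed lim_const)
    qed measurable
    then show "m (\<lambda>_. 1) = 1" using pos by (simp add: m_def A_def[symmetric])
  qed
  moreover have "m (\<lambda>x. F (h \<otimes> x)) = m F" if h: "h \<in> S" for h F
  proof -
    have hc: "h \<in> carrier G" using h S by auto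
    have "(\<integral>\<omega>. indicator A \<omega> * f (\<lambda>x. F (h \<otimes> x)) (walk G \<omega>) \<partial>\<Omega>) =
        (\<integral>\<omega>. indicator A \<omega> * f F (walk G \<omega>) \<partial>\<Omega>)"
    proof (rule integral_cong_AE)
      show "AE \<omega> in \<Omega>. indicator A \<omega> * f (\<lambda>x. F (h \<otimes> x)) (walk G \<omega>) = indicator A \<omega> * f F (walk G \<omega>)"
        using AE_increments_carrier AE_fixed_shift_invariant_function[OF fm fshift hc, of F]
      proof eventually_elim
        case (elim \<omega>)
        have "f (\<lambda>x. F (h \<otimes> x)) (walk G \<omega>) = f F (path h \<omega>)"
          using elim(1) hc by (simp add: f_def path_act_def u_translate walk_closed)
        then show ?case using elim(2) h by (auto simp: indicator_def A_def)
      qed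
    qed measurable
    then show ?thesis by (simp add: m_def)
  qed
  ultimately show ?thesis by blast
qed

text \<open>A finite set that fixes boundary points with probability 0 lies in almost no stabilizer.
  Discarding these countably many null events leaves points for which every finite part of the
  stabilizer has an invariant mean.\<close>

theorem AE_stabilizer_amenable: "AE x in B. amenable_subgroup G (stabilizer G act x)"
proof -
  let ?A = "\<lambda>S. {\<omega>. \<forall>h\<in>S. act h (\<pi> (walk G \<omega>)) = \<pi> (walk G \<omega>)}"
  let ?Fin = "{S. finite S \<and> S \<subseteq> carrier G}"
  have "AE x in B. \<forall>S\<in>?Fin. (\<forall>h\<in>S. act h x = x) \<longrightarrow> 0 < inc.P.prob (?A S)"
  proof (subst AE_ball_countable, goal_cases)
    case 1
    then show ?case by (intro countable_Collect_finite_subset) simp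
  next
    case 2
    show ?case
    proof
      fix S assume "S \<in> ?Fin"
      then have S: "S \<subseteq> carrier G" by simp
      have fx: "{x \<in> space B. \<forall>g\<in>S. act g x = x} \<in> sets B" by (rule common_fixed_points_sets[OF S])
      show "AE x in B. (\<forall>h\<in>S. act h x = x) \<longrightarrow> 0 < inc.P.prob (?A S)"
      proof (cases "0 < inc.P.prob (?A S)")
        case False
        then have "inc.P.prob (?A S) = 0" using measure_nonneg[of \<Omega> "?A S"] by linarith
        moreover have "(\<lambda>\<omega>. \<pi> (walk G \<omega>)) -` {x \<in> space B. \<forall>g\<in>S. act g x = x} \<inter> space \<Omega> \<in> sets \<Omega>"
          by (rule measurable_sets[OF measurable_compose[OF measurable_walk_path \<pi>_measurable] fx])
        then have "?A S \<in> sets \<Omega>" by (simp add: vimage_def \<pi>_space)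
        ultimately have "AE \<omega> in \<Omega>. \<not> (\<forall>h\<in>S. act h (\<pi> (walk G \<omega>)) = \<pi> (walk G \<omega>))"
          by (intro AE_I[of _ _ "?A S"]) (auto simp: inc.P.emeasure_eq_measure)
        then have "AE x in B. \<not> (\<forall>h\<in>S. act h x = x)"
          using sets.sets_Collect_neg[OF fx] by (subst AE_boundary_iff) auto
        then show ?thesis by eventually_elim auto
      qed simp
    qed
  qed
  with AE_space show ?thesis
  proof eventually_elim
    case (elim x)
    show ?case
    proof (rule amenable_subgroupI[OF stabilizer_subgroup[OF elim(1)]])
      fix S assume "finite S" "S \<subseteq> stabilizer G act x"
      then have "S \<subseteq> carrier G" "0 < inc.P.prob (?A S)" using elim(2) by (auto simp: stabilizer_def)
      then show "\<exists>m. mean_on (carrier G) m \<and>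
          (\<forall>h\<in>S. \<forall>f. bounded (f ` carrier G) \<longrightarrow> m (\<lambda>x. f (h \<otimes> x)) = m f)"
        by (rule exists_mean_of_fixed_points)
    qed
  qed
qed

section \<open>The distribution of the stabilizer and its constancy\<close>

definition stab_event :: "'a set \<Rightarrow> (nat \<Rightarrow> 'a) set" where
  "stab_event K = {x. stabilizer G act (\<pi> x) = K}"

lemma stab_event_invariant: "stab_event K \<in> shift_invariant_sets"
proof -
  have "stab_event K = \<pi> -` {x \<in> space B. stabilizer G act x = K}"
    by (auto simp: stab_event_def \<pi>_space)
  then show ?thesis using \<pi>_vimage_invariant[OF stabilizer_sets] by simp
qed

lemma stab_event_sets: "{\<omega>. walk G \<omega> \<in> stab_event K} \<in> sets \<Omega>"
  by (rule sets_path_in(2)[OF shift_invariant_sets_sets[OF stab_event_invariant]])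

lemma hit_one_stab_event: "hit \<one> (stab_event K) = inc.P.prob {\<omega>. walk G \<omega> \<in> stab_event K}"
  by (rule hit_one[OF shift_invariant_sets_sets[OF stab_event_invariant]])

text \<open>By equivariance, moving the starting point conjugates the stabilizer, so varying
  \<open>g\<close> compares the probabilities of conjugate subgroups.\<close>

lemma hit_stab_event_conjugate:
  assumes g: "g \<in> carrier G" and K: "K \<subseteq> carrier G"
  shows "hit g (stab_event K) = hit \<one> (stab_event ((\<lambda>k. inv g \<otimes> k \<otimes> g) ` K))"
  unfolding hit_one_stab_event unfolding hit_def
proof (rule measure_eq_AE)
  show "AE \<omega> in \<Omega>. (\<omega> \<in> {\<omega>. path g \<omega> \<in> stab_event K}) =
      (\<omega> \<in> {\<omega>. walk G \<omega> \<in> stab_event ((\<lambda>k. inv g \<otimes> k \<otimes> g) ` K)})"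
    using AE_\<pi>_equivariant[OF g]
    by eventually_elim (simp add: stab_event_def stabilizer_act_iff[OF g \<pi>_space K])
qed (rule stab_event_sets sets_path_in(1) shift_invariant_sets_sets stab_event_invariant)+

text \<open>The events for different subgroups are disjoint, so at most 1/d of them can have
  probability \<open>d\<close> or more.\<close>

lemma finite_large_stab_events:
  assumes "0 < d"
  shows "finite {K. d \<le> hit \<one> (stab_event K)}"
proof (rule ccontr)
  assume "infinite {K. d \<le> hit \<one> (stab_event K)}"
  moreover obtain n where n: "1 < real n * d" using reals_Archimedean3[OF assms] by blast
  ultimately obtain T where T: "finite T" "card T = n" "T \<subseteq> {K. d \<le> hit \<one> (stab_event K)}"
    using infinite_arbitrarily_large by blast
  have "real n * d = (\<Sum>K\<in>T. d)" using T by simp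
  also have "\<dots> \<le> (\<Sum>K\<in>T. hit \<one> (stab_event K))" using T by (intro sum_mono) auto
  also have "\<dots> = inc.P.prob (\<Union>K\<in>T. {\<omega>. walk G \<omega> \<in> stab_event K})"
    unfolding hit_one_stab_event using T stab_event_sets
    by (intro inc.P.finite_measure_finite_Union[symmetric])
      (auto simp: disjoint_family_on_def stab_event_def)
  also have "\<dots> \<le> 1" by simp
  finally show False using n by simp
qed

theorem stabilizer_constant:
  assumes cnt: "countable {H. amenable_subgroup G H}"
  shows "\<exists>N. N \<lhd> G \<and> amenable_subgroup G N \<and> (AE x in B. stabilizer G act x = N)"
proof -
  let ?p = "\<lambda>K. hit \<one> (stab_event K)"
  have "AE x in distr \<Omega> B (\<lambda>\<omega>. \<pi> (walk G \<omega>)). amenable_subgroup G (stabilizer G act x)"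
    using AE_stabilizer_amenable by (simp only: B_eq_distr[symmetric])
  then have am: "AE \<omega> in \<Omega>. amenable_subgroup G (stabilizer G act (\<pi> (walk G \<omega>)))"
    by (rule AE_distrD[OF measurable_compose[OF measurable_walk_path \<pi>_measurable]])
  have null: "AE \<omega> in \<Omega>. walk G \<omega> \<notin> stab_event K" if "?p K = 0" for K
    using that stab_event_sets unfolding hit_one_stab_event
    by (intro AE_I[of _ _ "{\<omega>. walk G \<omega> \<in> stab_event K}"]) (auto simp: inc.P.emeasure_eq_measure)
  \<comment> \<open>Here countability enters: were every value null, so would be the countable union
    over amenable subgroups, which carries full measure.\<close>
  have "\<exists>K. 0 < ?p K"
  proof (rule ccontr)
    assume "\<nexists>K. 0 < ?p K"
    then have "?p K = 0" for K using hit_bounds(1) by (metis less_eq_real_def)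
    then have "AE \<omega> in \<Omega>. \<forall>K\<in>{H. amenable_subgroup G H}. walk G \<omega> \<notin> stab_event K"
      using null by (subst AE_ball_countable[OF cnt]) blast
    with am have "AE \<omega> in \<Omega>. False" by eventually_elim (auto simp: stab_event_def)
    then show False by simp
  qed
  then obtain K1 where K1: "0 < ?p K1" ..
  \<comment> \<open>Only finitely many subgroups are at least as likely as \<open>K1\<close>, so a
    maximum over them exists; it is a maximum over all subgroups.\<close>
  let ?T = "{K. ?p K1 \<le> ?p K}"
  have T: "finite (?p ` ?T)" "?p ` ?T \<noteq> {}" using finite_large_stab_events[OF K1] by auto
  from Max_in[OF T] obtain N where N: "N \<in> ?T" "?p N = Max (?p ` ?T)" by force
  have max: "?p K \<le> ?p N" for K
  proof (cases "K \<in> ?T")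
    case True
    then show ?thesis unfolding N(2) by (intro Max_ge T) auto
  next
    case False
    then show ?thesis using N(1) by auto
  qed
  have pos: "0 < ?p N" using K1 N(1) by auto
  have "amenable_subgroup G N"
  proof (rule ccontr)
    assume "\<not> amenable_subgroup G N"
    with am have "AE \<omega> in \<Omega>. \<omega> \<notin> {\<omega>. walk G \<omega> \<in> stab_event N}"
      by (auto elim!: eventually_mono simp: stab_event_def)
    then have "inc.P.prob {\<omega>. walk G \<omega> \<in> stab_event N} = 0"
      using stab_event_sets by (subst inc.P.prob_eq_0) auto
    then show False using pos by (simp add: hit_one_stab_event)
  qed
  then have sub: "subgroup N G" by (simp add: amenable_subgroup_def)
  then have Nc: "N \<subseteq> carrier G" by (rule subgroup.subset)
  \<comment> \<open>From \<open>g\<close> the probability is that of a conjugate of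
    \<open>N\<close>, which cannot exceed the maximum attained at \<open>\<one>\<close>.\<close>
  have const: "hit g (stab_event N) = ?p N" if "g \<in> carrier G" for g
  proof (rule harmonic_maximum_principle[OF harmonic_hit[OF stab_event_invariant] hit_bounds(3) _ that])
    fix g assume g: "g \<in> carrier G"
    show "hit g (stab_event N) \<le> ?p N"
      unfolding hit_stab_event_conjugate[OF g Nc] by (rule max)
  qed
  have one: "?p N = 1"
    using hit_zero_one[OF stab_event_invariant const] pos by auto
  have AE1: "AE \<omega> in \<Omega>. walk G \<omega> \<in> stab_event K" if "?p K = 1" for K
    using inc.P.AE_in_set_eq_1[OF stab_event_sets, of K] that by (simp add: hit_one_stab_event)
  \<comment> \<open>\<open>N\<close> and its conjugate are both the stabilizer almost surely. Two
    such events meet, and the resulting equality does not involve the sample point.\<close>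
  have conj: "(\<lambda>k. inv g \<otimes> k \<otimes> g) ` N = N" if g: "g \<in> carrier G" for g
  proof -
    have "?p ((\<lambda>k. inv g \<otimes> k \<otimes> g) ` N) = 1"
      using hit_stab_event_conjugate[OF g Nc] const[OF g] one by simp
    from AE1[OF this] AE1[OF one]
    have "AE \<omega> in \<Omega>. (\<lambda>k. inv g \<otimes> k \<otimes> g) ` N = N"
      by eventually_elim (simp add: stab_event_def)
    then show ?thesis by simp
  qed
  have "N \<lhd> G"
    unfolding normal_inv_iff
  proof (intro conjI ballI sub)
    fix x h assume "x \<in> carrier G" "h \<in> N"
    \<comment> \<open>The normality criterion conjugates in the opposite direction, hence the
      instance at \<open>inv x\<close>.\<close>
    then show "x \<otimes> h \<otimes> inv x \<in> N" using conj[of "inv x"] by (auto simp: image_iff)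
  qed
  moreover have "AE x in B. stabilizer G act x = N"
    using AE1[OF one] unfolding AE_boundary_iff[OF stabilizer_sets] by (simp add: stab_event_def)
  ultimately show ?thesis using \<open>amenable_subgroup G N\<close> by blast
qed

end

theorem theorem5p1:
  fixes G :: "('a::countable, 'b) monoid_scheme" and \<mu> :: "'a pmf"
    and B :: "('c::polish_space) measure" and act :: "'a \<Rightarrow> 'c \<Rightarrow> 'c"
    and \<pi> :: "(nat \<Rightarrow> 'a) \<Rightarrow> 'c"
  assumes "group G"
    and "generating G \<mu>"
    and "countable {H. amenable_subgroup G H}"
    and "poisson_boundary G \<mu> B act \<pi>"
  shows "\<exists>N. N \<lhd> G \<and> amenable_subgroup G N \<and>
           (AE x in B. stabilizer G act x = N)"
proof -
  interpret group G by fact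
  interpret poisson_boundary_realization G \<mu> B act \<pi>
    by unfold_locales fact+
  show ?thesis by (rule stabilizer_constant) fact
qed

end
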